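(* Let $\mathfrak{a}$ be a discrete valuation ring with maximal ideal $\mathfrak{p}$ whose residue field $\mathfrak{k}=\mathfrak{a}/\mathfrak{p}$ is finite of order $q$. Let $\alpha=(\alpha_1,\dots,\alpha_r)$ and $\beta=(\beta_1,\dots,\beta_s)$ be partitions with $\beta\subseteq\alpha$, and let $M$ be a finite $\mathfrak{a}$-module of type $\alpha'$. Then the number of submodules of $M$ of type $\beta'$ is $$S(\alpha',\beta',q)=\prod_{i=1}^s \genfrac{[}{]}{0pt}{}{\alpha_i-\beta_{i+1}}{\beta_i-\beta_{i+1}}_q\, q^{\beta_{i+1}(\alpha_i-\beta_i)},$$ where $\beta_{s+1}$ is taken to be $0$.
   Context: Partitions are weakly decreasing sequences of non-negative integers; $\lambda'$ denotes the conjugate partition of $\lambda$; $\beta\subseteq\alpha$ means $\beta_i\le\alpha_i$ for all $i$ (missing parts read as $0$). A finite $\mathfrak{a}$-module has type $\lambda=(\lambda_1,\lambda_2,\dots)$ if it is isomorphic to $\bigoplus_i \mathfrak{a}/\mathfrak{p}^{\lambda_i}$. The Gaussian coefficient $\genfrac{[}{]}{0pt}{}{m}{k}_q=\frac{(q^m-1)\cdots(q^m-q^{k-1})}{(q^k-1)\cdots(q^k-q^{k-1})}$. *)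

theory Defs
  imports "HOL-Algebra.Algebra" "HOL-Library.More_List"
begin

text \<open>A discrete valuation ring is a local principal ideal domain that is not a field;
  the maximal ideal is a parameter of the locale.\<close>

locale discrete_valuation_ring = principal_domain R + maximalideal P R
  for R (structure) and P +
  assumes maximalideal_unique: "maximalideal I R \<Longrightarrow> I = P"
    and maximalideal_nonzero: "P \<noteq> {\<zero>}"


text \<open>Records of type \<^typ>\<open>('a, 'b) module\<close> extend ring records, so they also carry a
  multiplication and a unit. These two fields play no role for modules: neither
  \<^const>\<open>module\<close>, \<^const>\<open>submodule\<close> nor the isomorphisms below look at them.\<close>

definition quotient_module :: "('a, 'm) ring_scheme \<Rightarrow> 'a set \<Rightarrow> ('a, 'a set) module"
  where "quotient_module R I = ring.extend (R Quot I)
    (module.fields (\<lambda>r C. rcoset_mult R I (I +>\<^bsub>R\<^esub> r) C))"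

text \<open>The direct sum of finitely many modules; extensional functions represent tuples.
  For an infinite index set this would be the direct product.\<close>

definition finite_direct_sum ::
    "'i set \<Rightarrow> ('i \<Rightarrow> ('a, 'b, 'm) module_scheme) \<Rightarrow> ('a, 'i \<Rightarrow> 'b) module"
  where "finite_direct_sum J N =
    \<lparr>carrier = (\<Pi>\<^sub>E i\<in>J. carrier (N i)),
     monoid.mult = (\<lambda>x y. \<lambda>i\<in>J. x i \<otimes>\<^bsub>N i\<^esub> y i),
     one = (\<lambda>i\<in>J. \<one>\<^bsub>N i\<^esub>),
     ring.zero = (\<lambda>i\<in>J. \<zero>\<^bsub>N i\<^esub>),
     add = (\<lambda>x y. \<lambda>i\<in>J. x i \<oplus>\<^bsub>N i\<^esub> y i),
     module.smult = (\<lambda>r x. \<lambda>i\<in>J. r \<odot>\<^bsub>N i\<^esub> x i)\<rparr>"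

definition module_iso ::
    "('a, 'k) ring_scheme \<Rightarrow> ('a, 'b, 'm) module_scheme \<Rightarrow> ('a, 'c, 'n) module_scheme \<Rightarrow> ('b \<Rightarrow> 'c) set"
  where "module_iso R M N =
    {h \<in> iso (add_monoid M) (add_monoid N).
       \<forall>r\<in>carrier R. \<forall>x\<in>carrier M. h (r \<odot>\<^bsub>M\<^esub> x) = r \<odot>\<^bsub>N\<^esub> h x}"


text \<open>Partitions are lists, possibly with trailing zeros. List positions count from 0, so the
  part with number \<open>i + 1\<close> of \<open>xs\<close> is \<open>nth_default 0 xs i\<close>, which is 0 beyond the end.\<close>

definition is_partition :: "nat list \<Rightarrow> bool"
  where "is_partition xs \<longleftrightarrow> sorted_wrt (\<ge>) xs"

definition partition_subset :: "nat list \<Rightarrow> nat list \<Rightarrow> bool"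
  where "partition_subset xs ys \<longleftrightarrow> (\<forall>i. nth_default 0 xs i \<le> nth_default 0 ys i)"

text \<open>The part with number \<open>j + 1\<close> of the conjugate is the number of parts that are at
  least \<open>j + 1\<close>; the number of nonzero parts of the conjugate is the first part of \<open>xs\<close>.\<close>

definition conjugate_partition :: "nat list \<Rightarrow> nat list"
  where "conjugate_partition xs =
    map (\<lambda>j. card {i. i < length xs \<and> Suc j \<le> xs ! i}) [0..<nth_default 0 xs 0]"

text \<open>Powers of \<open>P\<close> are formed in the multiplicative monoid of ideals of \<open>R\<close>,
  so \<open>P\<close> to the power 0 is the unit ideal and parts equal to 0 contribute zero modules.\<close>

definition has_type ::
    "('a, 'k) ring_scheme \<Rightarrow> 'a set \<Rightarrow> ('a, 'b, 'm) module_scheme \<Rightarrow> nat list \<Rightarrow> bool"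
  where "has_type R P M xs \<longleftrightarrow>
    module_iso R M
      (finite_direct_sum {..<length xs}
        (\<lambda>i. quotient_module R (P [^]\<^bsub>ideals_set R\<^esub> (xs ! i)))) \<noteq> {}"


definition gauss_coeff :: "nat \<Rightarrow> nat \<Rightarrow> rat \<Rightarrow> rat"
  where "gauss_coeff m k q = (\<Prod>j<k. q ^ m - q ^ j) / (\<Prod>j<k. q ^ k - q ^ j)"

end

theory Submission
  imports Defs
begin

text \<open>Let p generate the maximal ideal P. A module has type \<mu> = (\<mu> 0, \<dots>, \<mu> (k - 1)) exactly when it is
spanned by a family f of length k that is \<^emph>\<open>independent with orders \<mu>\<close>: a combination
of the f i with coefficients r i vanishes precisely when each r i lies in the power of P with
exponent \<mu> i (\<open>has_type_iff_basis\<close>). Counting submodules is therefore counting such families.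
Each of them spans one submodule of M, and that submodule has type \<mu>. Conversely, every
independent family with orders \<mu> inside a submodule N of type \<mu> spans N, because its span and N
are isomorphic to the same finite module. Hence the number of submodules of type \<mu> is the
number of families in M divided by the number of families in any one N of type \<mu>.\<close>

text \<open>The families can be counted because independence is visible in the socle: f is independent
with positive orders \<mu> if and only if the vectors p^(\<mu> i - 1) f i lie in the socle and are linearly
independent over the residue field (\<open>independent_iff_socle\<close>). If \<mu> is decreasing, the first i socle vectors lie in the image of
multiplication by p^(\<mu> i - 1), and they span q^i elements. So the admissible choices for f i are the
elements killed by p^(\<mu> i), except for those that p^(\<mu> i - 1) sends into that span; the exceptions number
q^i times the order of the p^(\<mu> i - 1)-torsion (\<open>card_families_Suc\<close>). In a module of type \<alpha>' the
p^m-torsion has q to the power \<alpha> 0 + \<dots> + \<alpha> (m - 1) elements (\<open>card_torsion_of_type\<close>).\<close>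

text \<open>For \<mu> = \<beta>' the indices i with \<mu> i = m + 1 are those with \<beta> (m + 1) \<le> i < \<beta> m. Over such a block the
factors of the quotient of the two counts multiply to a Gaussian coefficient and a power of q, and
summation by parts brings the powers of q into the stated form (\<open>quotient_of_counts_eq_gauss_coeffs\<close>).\<close>

section \<open>Linear combinations and spans\<close>

text \<open>The sum is defined by recursion rather than as a finite sum in the additive monoid of M because
it then depends only on the operations of M: combinations in M and in a submodule are the same.\<close>

primrec lincomb :: "('a, 'b, 'm) module_scheme \<Rightarrow> (nat \<Rightarrow> 'a) \<Rightarrow> (nat \<Rightarrow> 'b) \<Rightarrow> nat \<Rightarrow> 'b"
  where "lincomb M r f 0 = \<zero>\<^bsub>M\<^esub>"
  | "lincomb M r f (Suc k) = lincomb M r f k \<oplus>\<^bsub>M\<^esub> r k \<odot>\<^bsub>M\<^esub> f k"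

definition span_of ::
    "('a, 'k) ring_scheme \<Rightarrow> ('a, 'b, 'm) module_scheme \<Rightarrow> (nat \<Rightarrow> 'b) \<Rightarrow> nat \<Rightarrow> 'b set"
  where "span_of R M f k = {lincomb M r f k | r. r \<in> UNIV \<rightarrow> carrier R}"

text \<open>One notion serves two purposes: with powers of a maximal ideal for the I i it says that f is a
basis of its span with prescribed orders, and with the maximal ideal itself for every I i it is
linear independence over the residue field of vectors killed by that ideal.\<close>

definition independent_mod ::
    "('a, 'k) ring_scheme \<Rightarrow> ('a, 'b, 'm) module_scheme \<Rightarrow> (nat \<Rightarrow> 'a set) \<Rightarrow>
      (nat \<Rightarrow> 'b) \<Rightarrow> nat \<Rightarrow> bool"
  where "independent_mod R M I f k \<longleftrightarrow> (\<forall>i<k. f i \<in> carrier M) \<and>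
    (\<forall>r \<in> UNIV \<rightarrow> carrier R. lincomb M r f k = \<zero>\<^bsub>M\<^esub> \<longleftrightarrow> (\<forall>i<k. r i \<in> I i))"

lemma span_ofI: "r \<in> UNIV \<rightarrow> carrier R \<Longrightarrow> lincomb M r f k \<in> span_of R M f k"
  unfolding span_of_def by blast

lemma span_ofE:
  assumes "x \<in> span_of R M f k"
  obtains r where "r \<in> UNIV \<rightarrow> carrier R" "x = lincomb M r f k"
  using assms unfolding span_of_def by blast

lemma lincomb_carrier_update: "lincomb (M\<lparr>carrier := N\<rparr>) r f k = lincomb M r f k"
  by (induction k) auto

lemma lincomb_cong:
  "(\<And>i. i < k \<Longrightarrow> r i \<odot>\<^bsub>M\<^esub> f i = s i \<odot>\<^bsub>M\<^esub> g i) \<Longrightarrow> lincomb M r f k = lincomb M s g k"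
  by (induction k) auto

lemma card_eq_if_module_iso:
  assumes "module_iso R M N \<noteq> {}"
  shows "card (carrier M) = card (carrier N)"
proof -
  obtain h where "bij_betw h (carrier M) (carrier N)"
    using assms by (auto simp: module_iso_def iso_def)
  then show ?thesis
    by (rule bij_betw_same_card)
qed

context module
begin

lemma lincomb_closed [simp]:
  "r \<in> UNIV \<rightarrow> carrier R \<Longrightarrow> (\<And>i. i < k \<Longrightarrow> f i \<in> carrier M) \<Longrightarrow> lincomb M r f k \<in> carrier M"
  by (induction k) (auto simp: Pi_iff)

lemma lincomb_zero:
  "(\<And>i. i < k \<Longrightarrow> r i \<odot>\<^bsub>M\<^esub> f i = \<zero>\<^bsub>M\<^esub>) \<Longrightarrow> lincomb M r f k = \<zero>\<^bsub>M\<^esub>"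
  by (induction k) auto

lemma lincomb_add:
  assumes "r \<in> UNIV \<rightarrow> carrier R" "s \<in> UNIV \<rightarrow> carrier R" "\<And>i. i < k \<Longrightarrow> f i \<in> carrier M"
  shows "lincomb M (\<lambda>i. r i \<oplus> s i) f k = lincomb M r f k \<oplus>\<^bsub>M\<^esub> lincomb M s f k"
  using assms(3)
proof (induction k)
  case (Suc k)
  have "lincomb M r f k \<in> carrier M" "lincomb M s f k \<in> carrier M"
    "r k \<odot>\<^bsub>M\<^esub> f k \<in> carrier M" "s k \<odot>\<^bsub>M\<^esub> f k \<in> carrier M"
    using Suc.prems assms(1,2) by (auto simp: Pi_iff)
  with Suc assms(1,2) show ?case
    by (simp add: Pi_iff smult_l_distr M.a_ac)
qed simp

lemma lincomb_smult:
  assumes "a \<in> carrier R" "r \<in> UNIV \<rightarrow> carrier R" "\<And>i. i < k \<Longrightarrow> f i \<in> carrier M"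
  shows "lincomb M (\<lambda>i. a \<otimes> r i) f k = a \<odot>\<^bsub>M\<^esub> lincomb M r f k"
  using assms(3)
proof (induction k)
  case (Suc k)
  then show ?case
    using assms(1,2) by (simp add: Pi_iff smult_r_distr smult_assoc1)
qed (simp add: assms(1))

lemma lincomb_minus:
  assumes "r \<in> UNIV \<rightarrow> carrier R" "s \<in> UNIV \<rightarrow> carrier R" "\<And>i. i < k \<Longrightarrow> f i \<in> carrier M"
  shows "lincomb M (\<lambda>i. r i \<ominus> s i) f k = lincomb M r f k \<ominus>\<^bsub>M\<^esub> lincomb M s f k"
proof -
  have "lincomb M (\<lambda>i. r i \<ominus> s i) f k = lincomb M (\<lambda>i. r i \<oplus> (\<ominus> \<one>) \<otimes> s i) f k"
    using assms by (intro lincomb_cong arg_cong2[where f = "(\<odot>\<^bsub>M\<^esub>)"])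
      (auto simp: Pi_iff R.minus_eq R.l_minus)
  also have "\<dots> = lincomb M r f k \<oplus>\<^bsub>M\<^esub> (\<ominus> \<one>) \<odot>\<^bsub>M\<^esub> lincomb M s f k"
    using assms by (simp add: Pi_iff lincomb_add lincomb_smult)
  finally show ?thesis
    using assms by (simp add: smult_l_minus M.minus_eq)
qed

lemma lincomb_scale_vectors:
  assumes "r \<in> UNIV \<rightarrow> carrier R" "\<And>i. i < k \<Longrightarrow> c i \<in> carrier R" "\<And>i. i < k \<Longrightarrow> f i \<in> carrier M"
  shows "lincomb M r (\<lambda>i. c i \<odot>\<^bsub>M\<^esub> f i) k = lincomb M (\<lambda>i. r i \<otimes> c i) f k"
  using assms by (intro lincomb_cong) (auto simp: Pi_iff smult_assoc1)

lemma lincomb_single: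
  assumes "a \<in> carrier R" "j < k" "\<And>i. i < k \<Longrightarrow> f i \<in> carrier M"
  shows "lincomb M (\<lambda>i. if i = j then a else \<zero>) f k = a \<odot>\<^bsub>M\<^esub> f j"
  using assms(2,3)
proof (induction k)
  case (Suc k)
  show ?case
  proof (cases "j = k")
    case True
    have "lincomb M (\<lambda>i. if i = j then a else \<zero>) f k = \<zero>\<^bsub>M\<^esub>"
      using Suc.prems True by (intro lincomb_zero) auto
    then show ?thesis
      using Suc.prems True assms(1) by simp
  next
    case False
    then show ?thesis
      using Suc assms(1) by (simp)
  qed
qed simp

lemma span_of_submodule:
  assumes f: "\<And>i. i < k \<Longrightarrow> f i \<in> carrier M"
  shows "submodule (span_of R M f k) R M"
proof (rule submoduleI)
  show subset: "span_of R M f k \<subseteq> carrier M"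
    using f by (auto elim!: span_ofE)
  have "lincomb M (\<lambda>_. \<zero>) f k = \<zero>\<^bsub>M\<^esub>"
    using f by (intro lincomb_zero) auto
  moreover have "lincomb M (\<lambda>_. \<zero>) f k \<in> span_of R M f k"
    by (intro span_ofI) auto
  ultimately show "\<zero>\<^bsub>M\<^esub> \<in> span_of R M f k"
    by simp
  show smult: "a \<odot>\<^bsub>M\<^esub> x \<in> span_of R M f k" if a: "a \<in> carrier R" and x: "x \<in> span_of R M f k" for a x
  proof -
    obtain r where r: "r \<in> UNIV \<rightarrow> carrier R" "x = lincomb M r f k"
      using x by (rule span_ofE)
    have "lincomb M (\<lambda>i. a \<otimes> r i) f k \<in> span_of R M f k"
      using r a by (intro span_ofI) auto
    then show ?thesis
      using r a f by (simp add: lincomb_smult)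
  qed
  show "x \<oplus>\<^bsub>M\<^esub> y \<in> span_of R M f k" if x: "x \<in> span_of R M f k" and y: "y \<in> span_of R M f k" for x y
  proof -
    obtain r where r: "r \<in> UNIV \<rightarrow> carrier R" "x = lincomb M r f k"
      using x by (rule span_ofE)
    obtain s where s: "s \<in> UNIV \<rightarrow> carrier R" "y = lincomb M s f k"
      using y by (rule span_ofE)
    have "lincomb M (\<lambda>i. r i \<oplus> s i) f k \<in> span_of R M f k"
      using r s by (intro span_ofI) auto
    then show ?thesis
      using r s f by (simp add: lincomb_add)
  qed
  show "\<ominus>\<^bsub>M\<^esub> x \<in> span_of R M f k" if "x \<in> span_of R M f k" for x
  proof -
    have "x \<in> carrier M"
      using that subset by blast
    then have "\<ominus>\<^bsub>M\<^esub> x = (\<ominus> \<one>) \<odot>\<^bsub>M\<^esub> x"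
      by (simp add: smult_l_minus)
    then show ?thesis
      using smult[OF _ that] by simp
  qed
qed

lemma span_of_subset_submodule:
  assumes N: "submodule N R M" and f: "\<And>i. i < k \<Longrightarrow> f i \<in> N"
  shows "span_of R M f k \<subseteq> N"
proof -
  have "lincomb M r f k \<in> N" if "r \<in> UNIV \<rightarrow> carrier R" for r
    using f
  proof (induction k)
    case 0
    then show ?case
      using subgroup.one_closed[OF submodule.axioms(1)[OF N]] by simp
  next
    case (Suc k)
    then show ?case
      using that submoduleE(4,5)[OF N] by (auto simp: Pi_iff)
  qed
  then show ?thesis
    by (auto elim!: span_ofE)
qed

lemma generator_in_span:
  assumes "i < k" "\<And>i. i < k \<Longrightarrow> f i \<in> carrier M"
  shows "f i \<in> span_of R M f k"
proof -
  have "lincomb M (\<lambda>j. if j = i then \<one> else \<zero>) f k \<in> span_of R M f k"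
    by (intro span_ofI) auto
  then show ?thesis
    using assms by (simp add: lincomb_single)
qed

section \<open>Direct sums of cyclic modules\<close>

text \<open>The map that sends a coefficient vector to its class in the direct sum of the quotients by the I i.
An isomorphism onto that sum is the same as a spanning family for which the class of the
coefficients determines, and is determined by, the value of the linear combination.\<close>

definition cosets :: "(nat \<Rightarrow> 'a set) \<Rightarrow> nat \<Rightarrow> (nat \<Rightarrow> 'a) \<Rightarrow> nat \<Rightarrow> 'a set"
  where "cosets I k r = (\<lambda>i\<in>{..<k}. I i +>\<^bsub>R\<^esub> r i)"

abbreviation quotient_sum :: "(nat \<Rightarrow> 'a set) \<Rightarrow> nat \<Rightarrow> ('a, nat \<Rightarrow> 'a set) module"
  where "quotient_sum I k \<equiv> finite_direct_sum {..<k} (\<lambda>i. quotient_module R (I i))"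

context
  fixes I :: "nat \<Rightarrow> 'a set" and k :: nat
  assumes I: "i < k \<Longrightarrow> ideal (I i) R"
begin

lemma cosets_eq_iff:
  assumes "r \<in> UNIV \<rightarrow> carrier R" "s \<in> UNIV \<rightarrow> carrier R"
  shows "cosets I k r = cosets I k s \<longleftrightarrow> (\<forall>i<k. r i \<ominus> s i \<in> I i)"
proof -
  have "r i \<ominus> s i \<in> I i \<longleftrightarrow> I i +> r i = I i +> s i" if "i < k" for i
    using R.quotient_eq_iff_same_a_r_cos[OF I[OF that], of "r i" "s i"] assms by auto
  then show ?thesis
    by (auto simp: cosets_def fun_eq_iff restrict_def)
qed

lemma cosets_onto:
  assumes C: "C \<in> (\<Pi>\<^sub>E i\<in>{..<k}. a_rcosets (I i))"
  shows "\<exists>r \<in> UNIV \<rightarrow> carrier R. C = cosets I k r"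
proof -
  have "\<exists>x. x \<in> carrier R \<and> (i < k \<longrightarrow> C i = I i +> x)" for i
  proof (cases "i < k")
    case True
    then have "C i \<in> a_rcosets (I i)"
      using C by auto
    then show ?thesis
      by (auto simp: A_RCOSETS_def')
  qed auto
  then obtain r where r: "\<And>i. r i \<in> carrier R \<and> (i < k \<longrightarrow> C i = I i +> r i)"
    by metis
  then have "C = cosets I k r"
    using C by (auto simp: cosets_def PiE_iff extensional_def fun_eq_iff)
  then show ?thesis
    using r by auto
qed

lemma quotient_sum_carrier: "carrier (quotient_sum I k) = (\<Pi>\<^sub>E i\<in>{..<k}. a_rcosets (I i))"
  by (simp add: finite_direct_sum_def quotient_module_def ring.defs module.defs FactRing_def)

lemma cosets_in_quotient_sum:
  "r \<in> UNIV \<rightarrow> carrier R \<Longrightarrow> cosets I k r \<in> carrier (quotient_sum I k)"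
  unfolding quotient_sum_carrier by (auto simp: cosets_def A_RCOSETS_def' Pi_iff)

lemma quotient_sum_add:
  assumes "r \<in> UNIV \<rightarrow> carrier R" "s \<in> UNIV \<rightarrow> carrier R"
  shows "cosets I k r \<oplus>\<^bsub>quotient_sum I k\<^esub> cosets I k s = cosets I k (\<lambda>i. r i \<oplus> s i)"
proof -
  have ab: "abelian_subgroup (I i) R" if "i < k" for i
    using I[OF that] by (meson R.abelian_group_axioms abelian_subgroupI3 ideal_def)
  have "set_add R (I i +> r i) (I i +> s i) = I i +> (r i \<oplus> s i)" if "i < k" for i
    using assms by (intro abelian_subgroup.a_rcos_sum[OF ab[OF that]]) auto
  then show ?thesis
    by (auto simp: finite_direct_sum_def quotient_module_def ring.defs module.defs FactRing_def
      cosets_def fun_eq_iff)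
qed

lemma quotient_sum_smult:
  assumes "r \<in> UNIV \<rightarrow> carrier R" "a \<in> carrier R"
  shows "a \<odot>\<^bsub>quotient_sum I k\<^esub> cosets I k r = cosets I k (\<lambda>i. a \<otimes> r i)"
proof -
  have "rcoset_mult R (I i) (I i +> a) (I i +> r i) = I i +> (a \<otimes> r i)" if "i < k" for i
    using assms by (intro ideal.rcoset_mult_add[OF I[OF that]]) auto
  then show ?thesis
    by (auto simp: finite_direct_sum_def quotient_module_def ring.defs module.defs FactRing_def
      cosets_def fun_eq_iff)
qed

text \<open>The basis consists of the preimages of the unit vectors; the isomorphism then maps a combination
with coefficients r to the class of r.\<close>

lemma basis_if_iso_quotient_sum:
  assumes h: "h \<in> module_iso R M (quotient_sum I k)"
  shows "\<exists>f. independent_mod R M I f k \<and> span_of R M f k = carrier M"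
proof -
  let ?Q = "quotient_sum I k"
  have bij: "bij_betw h (carrier M) (carrier ?Q)"
    and add: "\<And>x y. x \<in> carrier M \<Longrightarrow> y \<in> carrier M \<Longrightarrow> h (x \<oplus>\<^bsub>M\<^esub> y) = h x \<oplus>\<^bsub>?Q\<^esub> h y"
    and smult: "\<And>r x. r \<in> carrier R \<Longrightarrow> x \<in> carrier M \<Longrightarrow> h (r \<odot>\<^bsub>M\<^esub> x) = r \<odot>\<^bsub>?Q\<^esub> h x"
    using h by (auto simp: module_iso_def iso_def hom_def)
  define unit where "unit j = (\<lambda>i. if i = j then \<one> else \<zero>)" for j :: nat
  have unit: "unit j \<in> UNIV \<rightarrow> carrier R" for j
    by (auto simp: unit_def)
  have "\<exists>x\<in>carrier M. h x = cosets I k (unit j)" for j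
  proof -
    have "cosets I k (unit j) \<in> h ` carrier M"
      using cosets_in_quotient_sum[OF unit] bij_betw_imp_surj_on[OF bij] by simp
    then show ?thesis
      by auto
  qed
  then obtain f where f: "\<And>j. f j \<in> carrier M" "\<And>j. h (f j) = cosets I k (unit j)"
    by metis
  have h_coset: "\<exists>r\<in>UNIV \<rightarrow> carrier R. h x = cosets I k r" if "x \<in> carrier M" for x
    using cosets_onto[of "h x"] bij_betwE[OF bij] that unfolding quotient_sum_carrier by simp
  have zero: "h \<zero>\<^bsub>M\<^esub> = cosets I k (\<lambda>_. \<zero>)"
  proof -
    obtain r where r: "r \<in> UNIV \<rightarrow> carrier R" "h \<zero>\<^bsub>M\<^esub> = cosets I k r"
      using h_coset[OF M.zero_closed] by auto
    \<comment> \<open>Multiplying by the scalar 0 identifies the image of 0 without appealing to the group structure of the direct sum.\<close>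
    have "h \<zero>\<^bsub>M\<^esub> = h (\<zero> \<odot>\<^bsub>M\<^esub> \<zero>\<^bsub>M\<^esub>)"
      by simp
    also have "\<dots> = cosets I k (\<lambda>i. \<zero> \<otimes> r i)"
      using smult[OF R.zero_closed M.zero_closed] quotient_sum_smult[OF r(1) R.zero_closed]
      by (simp only: r(2))
    also have "\<dots> = cosets I k (\<lambda>_. \<zero>)"
      using r by (intro arg_cong[where f = "cosets I k"]) (auto simp: Pi_iff)
    finally show ?thesis .
  qed
  \<comment> \<open>The induction on n truncates the coefficients, since the later unit vectors are not yet reached.\<close>
  have h_lincomb: "h (lincomb M r f n) = cosets I k (\<lambda>i. if i < n then r i else \<zero>)"
    if r: "r \<in> UNIV \<rightarrow> carrier R" for r n
  proof (induction n)
    case (Suc n)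
    have 1: "r n \<in> carrier R" "(\<lambda>i. if i < n then r i else \<zero>) \<in> UNIV \<rightarrow> carrier R"
      "(\<lambda>i. r n \<otimes> unit n i) \<in> UNIV \<rightarrow> carrier R"
      using r by (auto simp: unit_def Pi_iff)
    have "h (lincomb M r f (Suc n)) =
      cosets I k (\<lambda>i. (if i < n then r i else \<zero>) \<oplus> r n \<otimes> unit n i)"
      using f r Suc 1 add smult quotient_sum_add[OF 1(2,3)]
        quotient_sum_smult[OF unit 1(1)]
      by (simp add: Pi_iff)
    also have "(\<lambda>i. (if i < n then r i else \<zero>) \<oplus> r n \<otimes> unit n i) =
      (\<lambda>i. if i < Suc n then r i else \<zero>)"
      using r by (auto simp: unit_def fun_eq_iff Pi_iff less_Suc_eq)
    finally show ?case .
  qed (simp add: zero)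
  have h_lincomb: "h (lincomb M r f k) = cosets I k r" if r: "r \<in> UNIV \<rightarrow> carrier R" for r
    unfolding h_lincomb[OF r] by (auto simp: cosets_def fun_eq_iff)
  have "lincomb M r f k = \<zero>\<^bsub>M\<^esub> \<longleftrightarrow> (\<forall>i<k. r i \<in> I i)" if r: "r \<in> UNIV \<rightarrow> carrier R" for r
  proof -
    have "lincomb M r f k = \<zero>\<^bsub>M\<^esub> \<longleftrightarrow> h (lincomb M r f k) = h \<zero>\<^bsub>M\<^esub>"
      using bij f r by (auto simp: bij_betw_def inj_on_def Pi_iff)
    also have "\<dots> \<longleftrightarrow> (\<forall>i<k. r i \<ominus> \<zero> \<in> I i)"
      unfolding h_lincomb[OF r] zero by (rule cosets_eq_iff[OF r]) auto
    finally show ?thesis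
      using r by (simp add: Pi_iff R.minus_eq)
  qed
  moreover have "span_of R M f k = carrier M"
  proof (intro equalityI subsetI)
    fix x assume x: "x \<in> carrier M"
    then obtain r where r: "r \<in> UNIV \<rightarrow> carrier R" "h x = cosets I k r"
      using h_coset by auto
    then have "h x = h (lincomb M r f k)"
      using h_lincomb by simp
    then have "x = lincomb M r f k"
      using bij x f r by (auto simp: bij_betw_def inj_on_def Pi_iff)
    then show "x \<in> span_of R M f k"
      using r span_ofI by metis
  qed (use f in \<open>auto elim!: span_ofE\<close>)
  ultimately show ?thesis
    using f unfolding independent_mod_def by blast
qed

text \<open>Choosing coefficients c x for every x defines the isomorphism, because two coefficient vectors give
the same combination exactly when they have the same class.\<close>

lemma iso_quotient_sum_if_basis:
  assumes f: "independent_mod R M I f k" and span: "span_of R M f k = carrier M"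
  shows "module_iso R M (quotient_sum I k) \<noteq> {}"
proof -
  let ?Q = "quotient_sum I k"
  have fM: "\<And>i. i < k \<Longrightarrow> f i \<in> carrier M"
    and ind: "\<And>r. r \<in> UNIV \<rightarrow> carrier R \<Longrightarrow> lincomb M r f k = \<zero>\<^bsub>M\<^esub> \<longleftrightarrow> (\<forall>i<k. r i \<in> I i)"
    using f by (auto simp: independent_mod_def)
  have "\<exists>r. r \<in> UNIV \<rightarrow> carrier R \<and> (x \<in> carrier M \<longrightarrow> x = lincomb M r f k)" for x
    using span span_ofE[of x R M f k] by (cases "x \<in> carrier M") blast+
  then obtain c where c: "\<And>x. c x \<in> UNIV \<rightarrow> carrier R"
    and lc: "\<And>x. x \<in> carrier M \<Longrightarrow> lincomb M (c x) f k = x"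
    by metis
  define h where "h x = cosets I k (c x)" for x
  have eq_iff: "lincomb M r f k = lincomb M s f k \<longleftrightarrow> cosets I k r = cosets I k s"
    if rs: "r \<in> UNIV \<rightarrow> carrier R" "s \<in> UNIV \<rightarrow> carrier R" for r s
  proof -
    have cl: "lincomb M r f k \<in> carrier M" "lincomb M s f k \<in> carrier M"
      using rs fM by (auto simp: Pi_iff)
    have "lincomb M r f k = lincomb M s f k \<longleftrightarrow> lincomb M r f k \<ominus>\<^bsub>M\<^esub> lincomb M s f k = \<zero>\<^bsub>M\<^esub>"
      using cl by (simp add: M.minus_eq) (metis M.add.inv_closed M.add.inv_equality M.minus_minus M.r_neg)
    also have "\<dots> \<longleftrightarrow> lincomb M (\<lambda>i. r i \<ominus> s i) f k = \<zero>\<^bsub>M\<^esub>"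
      using rs fM by (subst lincomb_minus) auto
    also have "\<dots> \<longleftrightarrow> (\<forall>i<k. r i \<ominus> s i \<in> I i)"
      using rs by (intro ind) auto
    also have "\<dots> \<longleftrightarrow> cosets I k r = cosets I k s"
      using cosets_eq_iff[OF rs] by simp
    finally show ?thesis .
  qed
  have h_lincomb: "h (lincomb M r f k) = cosets I k r" if r: "r \<in> UNIV \<rightarrow> carrier R" for r
    using eq_iff[OF c r] lc[of "lincomb M r f k"] r fM by (auto simp: h_def Pi_iff)
  have "bij_betw h (carrier M) (carrier ?Q)"
  proof (rule bij_betw_imageI)
    show "inj_on h (carrier M)"
    proof (rule inj_onI)
      fix x y assume xy: "x \<in> carrier M" "y \<in> carrier M" "h x = h y"
      then show "x = y"
        using eq_iff[OF c c, of x y] lc[of x] lc[of y] by (simp add: h_def)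
    qed
    show "h ` carrier M = carrier ?Q"
    proof (intro equalityI subsetI)
      fix C assume "C \<in> h ` carrier M"
      then show "C \<in> carrier ?Q"
        using cosets_in_quotient_sum[OF c] by (auto simp: h_def)
    next
      fix C assume "C \<in> carrier ?Q"
      then obtain r where r: "r \<in> UNIV \<rightarrow> carrier R" "C = cosets I k r"
        using cosets_onto[of C] quotient_sum_carrier by auto
      then have "C = h (lincomb M r f k)" "lincomb M r f k \<in> carrier M"
        using h_lincomb fM by simp_all
      then show "C \<in> h ` carrier M"
        by blast
    qed
  qed
  moreover have "h (x \<oplus>\<^bsub>M\<^esub> y) = h x \<oplus>\<^bsub>?Q\<^esub> h y" if "x \<in> carrier M" "y \<in> carrier M" for x y
  proof -
    have "x \<oplus>\<^bsub>M\<^esub> y = lincomb M (\<lambda>i. c x i \<oplus> c y i) f k"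
      using that c fM lc by (subst lincomb_add) (auto simp: Pi_iff)
    then have "h (x \<oplus>\<^bsub>M\<^esub> y) = cosets I k (\<lambda>i. c x i \<oplus> c y i)"
      using c by (auto simp: Pi_iff intro!: h_lincomb)
    then show ?thesis
      unfolding h_def using quotient_sum_add[OF c c] by simp
  qed
  moreover have "h (a \<odot>\<^bsub>M\<^esub> x) = a \<odot>\<^bsub>?Q\<^esub> h x" if "a \<in> carrier R" "x \<in> carrier M" for a x
  proof -
    have "a \<odot>\<^bsub>M\<^esub> x = lincomb M (\<lambda>i. a \<otimes> c x i) f k"
      using that c fM lc by (subst lincomb_smult) (auto simp: Pi_iff)
    then have "h (a \<odot>\<^bsub>M\<^esub> x) = cosets I k (\<lambda>i. a \<otimes> c x i)"
      using c that by (auto simp: Pi_iff intro!: h_lincomb)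
    then show ?thesis
      unfolding h_def using quotient_sum_smult[OF c that(1)] by simp
  qed
  ultimately have "h \<in> module_iso R M ?Q"
    by (auto simp: module_iso_def iso_def hom_def bij_betw_def)
  then show ?thesis
    by blast
qed

end

end

section \<open>Conjugate partitions\<close>

lemma partition_antimono:
  assumes "is_partition xs" "i \<le> j"
  shows "nth_default 0 xs j \<le> nth_default 0 xs i"
proof (cases "i = j \<or> length xs \<le> j")
  case False
  then show ?thesis
    using assms by (auto simp: is_partition_def sorted_wrt_iff_nth_less nth_default_def)
qed (auto simp: nth_default_def)

lemma length_conjugate_partition: "length (conjugate_partition xs) = nth_default 0 xs 0"
  by (simp add: conjugate_partition_def)

text \<open>The parts exceeding i form an initial segment of positions, so position m belongs to it exactly
when its cardinality exceeds m. The condition on i keeps the index within the conjugate.\<close>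

lemma less_conjugate_partition_iff:
  assumes xs: "is_partition xs" and i: "i < nth_default 0 xs 0"
  shows "m < conjugate_partition xs ! i \<longleftrightarrow> i < nth_default 0 xs m"
proof -
  let ?D = "{l. l < length xs \<and> Suc i \<le> xs ! l}"
  have D: "l \<in> ?D \<longleftrightarrow> i < nth_default 0 xs l" for l
    by (auto simp: nth_default_def)
  have conj: "conjugate_partition xs ! i = card ?D"
    using i by (simp add: conjugate_partition_def)
  show ?thesis
  proof
    assume "m < conjugate_partition xs ! i"
    show "i < nth_default 0 xs m"
    proof (rule ccontr)
      assume "\<not> i < nth_default 0 xs m"
      then have "l < m" if "i < nth_default 0 xs l" for l
        using that partition_antimono[OF xs, of m l] by (cases "l < m") auto
      then have "?D \<subseteq> {..<m}"
        using D by blast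
      then have "card ?D \<le> m"
        using card_mono[of "{..<m}" ?D] by simp
      then show False
        using \<open>m < conjugate_partition xs ! i\<close> conj by simp
    qed
  next
    assume "i < nth_default 0 xs m"
    then have "i < nth_default 0 xs l" if "l \<le> m" for l
      using partition_antimono[OF xs that] by simp
    then have "{..m} \<subseteq> ?D"
      using D by blast
    then have "Suc m \<le> card ?D"
      using card_mono[of ?D "{..m}"] by simp
    then show "m < conjugate_partition xs ! i"
      using conj by simp
  qed
qed

section \<open>Regrouping a quotient of counts into Gaussian coefficients\<close>

text \<open>The intervals from b (m + 1) to b m tile the interval from b s to b 0.\<close>

lemma prod_over_blocks:
  fixes g :: "nat \<Rightarrow> 'a :: comm_monoid_mult"
  assumes "\<And>i j. i \<le> j \<Longrightarrow> b j \<le> b i"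
  shows "prod g {b s..<b 0} = (\<Prod>m<s. prod g {b (Suc m)..<b m})"
proof (induction s)
  case (Suc s)
  have "prod g {b (Suc s)..<b 0} = prod g {b (Suc s)..<b s} * prod g {b s..<b 0}"
    using assms by (simp add: prod.atLeastLessThan_concat)
  then show ?case
    using Suc by (simp add: mult.commute)
qed simp

text \<open>The index shift by c makes the factor x^c appear in the numerator and the denominator, where it cancels.\<close>

lemma gauss_coeff_eq_prod:
  fixes x :: rat
  assumes "x \<noteq> 0" "c \<le> b" "b \<le> a"
  shows "(\<Prod>i=c..<b. (x ^ a - x ^ i) / (x ^ b - x ^ i)) = gauss_coeff (a - c) (b - c) x"
proof -
  have pow: "x ^ n - x ^ (j + c) = x ^ c * (x ^ (n - c) - x ^ j)" if "c \<le> n" for n j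
    using that by (simp add: algebra_simps flip: power_add)
  have "(\<Prod>i=c..<b. (x ^ a - x ^ i) / (x ^ b - x ^ i)) =
      (\<Prod>j<b - c. (x ^ a - x ^ (j + c)) / (x ^ b - x ^ (j + c)))"
    using prod.shift_bounds_nat_ivl[of "\<lambda>i. (x ^ a - x ^ i) / (x ^ b - x ^ i)" 0 c "b - c"] assms(2)
    by (simp add: atLeast0LessThan)
  also have "\<dots> = (\<Prod>j<b - c. (x ^ (a - c) - x ^ j) / (x ^ (b - c) - x ^ j))"
    using assms by (intro prod.cong) (auto simp: pow)
  finally show ?thesis
    by (simp add: gauss_coeff_def prod_dividef)
qed

text \<open>Abel summation in the natural numbers. Stated with its boundary term, so that it can be proved by
induction; in the application b s is zero.\<close>

lemma sum_by_parts_antimono: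
  fixes b d :: "nat \<Rightarrow> nat"
  assumes "\<And>i j. i \<le> j \<Longrightarrow> b j \<le> b i"
  shows "(\<Sum>m<s. sum d {..<m} * (b m - b (Suc m))) + sum d {..<s} * b s = (\<Sum>m<s. b (Suc m) * d m)"
proof (induction s)
  case (Suc s)
  obtain e where "b s = b (Suc s) + e"
    using assms[of s "Suc s"] le_Suc_ex by auto
  then show ?case
    using Suc by (simp add: algebra_simps)
qed simp

text \<open>Here a and b are the parts of \<alpha> and \<beta>, and \<mu> is the conjugate of b. The factors of the quotient
for which \<mu> i = m + 1 have i in the interval from b (m + 1) to b m, where everything except
x^i is constant.\<close>

lemma quotient_of_counts_eq_gauss_coeffs:
  fixes x :: rat and a b \<mu> :: "nat \<Rightarrow> nat"
  assumes x: "x \<noteq> 0"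
    and b: "\<And>i j. i \<le> j \<Longrightarrow> b j \<le> b i" "b s = 0" and ab: "\<And>i. b i \<le> a i"
    and \<mu>: "\<And>i m. i < b 0 \<Longrightarrow> m < \<mu> i \<longleftrightarrow> i < b m"
  shows "(\<Prod>i<b 0. (x ^ sum a {..<\<mu> i - 1} * (x ^ a (\<mu> i - 1) - x ^ i)) /
      (x ^ sum b {..<\<mu> i - 1} * (x ^ b (\<mu> i - 1) - x ^ i))) =
    (\<Prod>m<s. gauss_coeff (a m - b (Suc m)) (b m - b (Suc m)) x * x ^ (b (Suc m) * (a m - b m)))"
    (is "prod ?g _ = _")
proof -
  let ?d = "\<lambda>m. a m - b m"
  have block: "prod ?g {b (Suc m)..<b m} =
      x ^ (sum ?d {..<m} * (b m - b (Suc m))) * gauss_coeff (a m - b (Suc m)) (b m - b (Suc m)) x" for m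
  proof -
    \<comment> \<open>As b \<le> a, truncated subtraction is harmless.\<close>
    have "sum a {..<m} = sum b {..<m} + sum ?d {..<m}"
      using ab by (simp flip: sum.distrib)
    then have frac: "x ^ sum a {..<m} / x ^ sum b {..<m} = x ^ sum ?d {..<m}"
      using x by (simp add: power_add)
    have "?g i = x ^ sum ?d {..<m} * ((x ^ a m - x ^ i) / (x ^ b m - x ^ i))"
      if "i \<in> {b (Suc m)..<b m}" for i
    proof -
      have "i < b 0"
        using that b(1)[of 0 m] by simp
      then have "m < \<mu> i" "\<not> Suc m < \<mu> i"
        using that \<mu> by auto
      then have "\<mu> i - 1 = m"
        by simp
      then show ?thesis
        using frac by (simp flip: times_divide_times_eq)
    qed
    then have "prod ?g {b (Suc m)..<b m} =
        (\<Prod>i=b (Suc m)..<b m. x ^ sum ?d {..<m} * ((x ^ a m - x ^ i) / (x ^ b m - x ^ i)))"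
      by (rule prod.cong[OF refl])
    also have "\<dots> = (\<Prod>i=b (Suc m)..<b m. x ^ sum ?d {..<m}) *
        (\<Prod>i=b (Suc m)..<b m. (x ^ a m - x ^ i) / (x ^ b m - x ^ i))"
      by (rule prod.distrib)
    finally show ?thesis
      using gauss_coeff_eq_prod[OF x b(1)[of m "Suc m"] ab[of m]]
      by (simp add: power_mult)
  qed
  have "prod ?g {..<b 0} = prod ?g {b s..<b 0}"
    by (simp add: b(2) atLeast0LessThan)
  also have "\<dots> = (\<Prod>m<s. prod ?g {b (Suc m)..<b m})"
    using b(1) by (rule prod_over_blocks)
  also have "\<dots> = (\<Prod>m<s. x ^ (sum ?d {..<m} * (b m - b (Suc m)))) *
      (\<Prod>m<s. gauss_coeff (a m - b (Suc m)) (b m - b (Suc m)) x)"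
    by (simp only: block prod.distrib)
  also have "(\<Prod>m<s. x ^ (sum ?d {..<m} * (b m - b (Suc m)))) = (\<Prod>m<s. x ^ (b (Suc m) * ?d m))"
    using sum_by_parts_antimono[of b ?d s] b by (simp flip: power_sum)
  finally show ?thesis
    by (simp add: prod.distrib mult.commute)
qed

section \<open>Powers of the maximal ideal\<close>

text \<open>Multiplication by a is additive, so every nonempty fiber is a translate of its kernel.\<close>

lemma (in module) card_vimage_smult:
  assumes fin: "finite (carrier M)" and a: "a \<in> carrier R"
    and S: "S \<subseteq> (\<lambda>x. a \<odot>\<^bsub>M\<^esub> x) ` carrier M"
  shows "card {x \<in> carrier M. a \<odot>\<^bsub>M\<^esub> x \<in> S} = card S * card {x \<in> carrier M. a \<odot>\<^bsub>M\<^esub> x = \<zero>\<^bsub>M\<^esub>}"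
proof -
  let ?K = "{x \<in> carrier M. a \<odot>\<^bsub>M\<^esub> x = \<zero>\<^bsub>M\<^esub>}"
  have "finite S"
    using S fin by (meson finite_surj)
  have fiber: "card {x \<in> carrier M. a \<odot>\<^bsub>M\<^esub> x = s} = card ?K" if "s \<in> S" for s
  proof -
    obtain y where y: "y \<in> carrier M" "s = a \<odot>\<^bsub>M\<^esub> y"
      using \<open>s \<in> S\<close> S by auto
    have "bij_betw (\<lambda>x. y \<oplus>\<^bsub>M\<^esub> x) ?K {x \<in> carrier M. a \<odot>\<^bsub>M\<^esub> x = s}"
    proof (rule bij_betw_byWitness[where f' = "\<lambda>x. \<ominus>\<^bsub>M\<^esub> y \<oplus>\<^bsub>M\<^esub> x"])
      show "\<forall>x\<in>?K. \<ominus>\<^bsub>M\<^esub> y \<oplus>\<^bsub>M\<^esub> (y \<oplus>\<^bsub>M\<^esub> x) = x"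
        using y by (auto simp: M.r_neg1)
      show "\<forall>x\<in>{x \<in> carrier M. a \<odot>\<^bsub>M\<^esub> x = s}. y \<oplus>\<^bsub>M\<^esub> (\<ominus>\<^bsub>M\<^esub> y \<oplus>\<^bsub>M\<^esub> x) = x"
        using y by (auto simp: M.r_neg2)
      show "(\<lambda>x. y \<oplus>\<^bsub>M\<^esub> x) ` ?K \<subseteq> {x \<in> carrier M. a \<odot>\<^bsub>M\<^esub> x = s}"
        using y a by (auto simp: smult_r_distr)
      show "(\<lambda>x. \<ominus>\<^bsub>M\<^esub> y \<oplus>\<^bsub>M\<^esub> x) ` {x \<in> carrier M. a \<odot>\<^bsub>M\<^esub> x = s} \<subseteq> ?K"
        using y a by (auto simp: smult_r_distr smult_r_minus M.l_neg)
    qed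
    then show ?thesis
      by (simp add: bij_betw_same_card)
  qed
  have "{x \<in> carrier M. a \<odot>\<^bsub>M\<^esub> x \<in> S} = (\<Union>s\<in>S. {x \<in> carrier M. a \<odot>\<^bsub>M\<^esub> x = s})"
    by auto
  also have "card \<dots> = (\<Sum>s\<in>S. card {x \<in> carrier M. a \<odot>\<^bsub>M\<^esub> x = s})"
    using \<open>finite S\<close> fin by (intro card_UN_disjoint) auto
  also have "\<dots> = card S * card ?K"
    using fiber by simp
  finally show ?thesis .
qed

locale module_over_dvr = module R M + discrete_valuation_ring R P
  for R (structure) and M (structure) and P +
  fixes p q
  assumes p_carrier [simp]: "p \<in> carrier R" and P_eq: "P = PIdl p"
    and finite_residues: "finite (carrier (R Quot P))"
    and q_def: "q = card (carrier (R Quot P))"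
    and finite_module: "finite (carrier M)"
begin

abbreviation Ppow :: "nat \<Rightarrow> 'a set"
  where "Ppow n \<equiv> PIdl (p [^] n)"

text \<open>Powers in the monoid of ideals are what types are defined with; for a principal ideal they reduce
to divisibility by powers of the generator.\<close>

lemma ideal_power: "P [^]\<^bsub>ideals_set R\<^esub> n = Ppow n"
proof (induction n)
  case 0
  have "Ppow 0 = carrier R"
    using ideal.one_imp_carrier[OF cgenideal_ideal[OF one_closed] cgenideal_self[OF one_closed]] by simp
  then show ?case
    by (simp add: nat_pow_def ideals_set_def)
next
  case (Suc n)
  have "P [^]\<^bsub>ideals_set R\<^esub> Suc n = ideal_prod R (Ppow n) (PIdl p)"
    using Suc by (simp add: nat_pow_def ideals_set_def P_eq)
  also have "\<dots> = Idl (PIdl (p [^] n \<otimes> p))"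
    by (simp add: ideal_prod_eq_genideal cgenideal_ideal cgenideal_prod)
  also have "\<dots> = Ppow (Suc n)"
    using cgenideal_ideal[of "p [^] n \<otimes> p"]
    by (simp add: equalityI genideal_minimal genideal_self ideal.Icarr subsetI)
  finally show ?case .
qed

lemma p_nonzero: "p \<noteq> \<zero>"
proof
  assume "p = \<zero>"
  then have "P = {\<zero>}"
    using P_eq cgenideal_eq_genideal[OF R.zero_closed] genideal_zero by simp
  then show False
    using maximalideal_nonzero by simp
qed

lemma in_PpowE:
  assumes "x \<in> Ppow n"
  obtains s where "s \<in> carrier R" "x = s \<otimes> p [^] n"
  using assms unfolding cgenideal_def by blast

lemma in_PpowI: "s \<in> carrier R \<Longrightarrow> s \<otimes> p [^] n \<in> Ppow n"
  unfolding cgenideal_def by blast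

lemma in_PE:
  assumes "x \<in> P"
  obtains s where "s \<in> carrier R" "x = s \<otimes> p"
  using assms unfolding P_eq cgenideal_def by blast

lemma in_PI: "s \<in> carrier R \<Longrightarrow> s \<otimes> p \<in> P"
  unfolding P_eq cgenideal_def by blast

text \<open>Cancellation of p is where the absence of zero divisors enters.\<close>

lemma Ppow_cancel_generator:
  assumes x: "x \<in> carrier R" and px: "p \<otimes> x \<in> Ppow (Suc n)"
  shows "x \<in> Ppow n"
proof -
  obtain s where s: "s \<in> carrier R" "p \<otimes> x = s \<otimes> p [^] Suc n"
    using px by (rule in_PpowE)
  then have "p \<otimes> x = p \<otimes> (s \<otimes> p [^] n)"
    by (simp add: m_ac)
  then have "x = s \<otimes> p [^] n"
    using m_lcancel[OF p_nonzero] x s by simp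
  then show ?thesis
    using s in_PpowI by simp
qed

lemma mult_power_in_Ppow_Suc_iff:
  assumes r: "r \<in> carrier R"
  shows "r \<otimes> p [^] n \<in> Ppow (Suc n) \<longleftrightarrow> r \<in> P"
proof
  assume "r \<in> P"
  then obtain s where "s \<in> carrier R" "r = s \<otimes> p"
    by (rule in_PE)
  then show "r \<otimes> p [^] n \<in> Ppow (Suc n)"
    using in_PpowI[of s "Suc n"] by (simp add: m_ac)
next
  assume "r \<otimes> p [^] n \<in> Ppow (Suc n)"
  then show "r \<in> P"
  proof (induction n)
    case 0
    then show ?case
      using r by (simp add: P_eq)
  next
    case (Suc n)
    have "p \<otimes> (r \<otimes> p [^] n) \<in> Ppow (Suc (Suc n))"
      using Suc.prems r by (simp add: m_ac)
    then show ?case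
      using Ppow_cancel_generator[of "r \<otimes> p [^] n" "Suc n"] r Suc.IH by simp
  qed
qed

lemma inverse_mod_P:
  assumes r: "r \<in> carrier R" "r \<notin> P"
  obtains s where "s \<in> carrier R" "s \<otimes> r \<ominus> \<one> \<in> P"
proof -
  interpret K: field "R Quot P"
    by (rule quotient_is_field[OF R.is_cring])
  have "P +> r \<in> carrier (R Quot P)" "P +> r \<noteq> \<zero>\<^bsub>R Quot P\<^esub>"
    using r a_rcos_self by (auto simp: FactRing_def A_RCOSETS_def')
  then have "P +> r \<in> Units (R Quot P)"
    by (simp add: K.field_Units)
  then obtain C where C: "C \<in> carrier (R Quot P)" "C \<otimes>\<^bsub>R Quot P\<^esub> (P +> r) = \<one>\<^bsub>R Quot P\<^esub>"
    by (auto simp: Units_def)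
  then obtain s where s: "s \<in> carrier R" "C = P +> s"
    by (auto simp: FactRing_def A_RCOSETS_def')
  then have "P +> (s \<otimes> r) = P +> \<one>"
    using C r rcoset_mult_add[of s r] by (simp add: FactRing_def)
  then have "s \<otimes> r \<ominus> \<one> \<in> P"
    using quotient_eq_iff_same_a_r_cos[OF is_ideal, of "s \<otimes> r" \<one>] s r by simp
  then show ?thesis
    using s that by blast
qed

section \<open>Independence in the socle\<close>

text \<open>The usual criterion for extending a linearly independent family by one vector. Independence modulo P
also forces P to kill the vectors, so the extension must lie in the socle.\<close>

lemma socle_independent_Suc:
  "independent_mod R M (\<lambda>_. P) e (Suc k) \<longleftrightarrow> independent_mod R M (\<lambda>_. P) e k \<and>
    e k \<in> carrier M \<and> p \<odot>\<^bsub>M\<^esub> e k = \<zero>\<^bsub>M\<^esub> \<and> e k \<notin> span_of R M e k"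
    (is "?L \<longleftrightarrow> ?R")
proof
  assume L: ?L
  then have eM: "\<And>i. i < Suc k \<Longrightarrow> e i \<in> carrier M"
    and ind: "\<And>r. r \<in> UNIV \<rightarrow> carrier R \<Longrightarrow>
      lincomb M r e (Suc k) = \<zero>\<^bsub>M\<^esub> \<longleftrightarrow> (\<forall>i<Suc k. r i \<in> P)"
    by (auto simp: independent_mod_def)
  have "lincomb M r e k = \<zero>\<^bsub>M\<^esub> \<longleftrightarrow> (\<forall>i<k. r i \<in> P)" if r: "r \<in> UNIV \<rightarrow> carrier R" for r
  proof -
    have "lincomb M (r(k := \<zero>)) e (Suc k) = lincomb M r e k"
    proof -
      have "lincomb M (r(k := \<zero>)) e k = lincomb M r e k"
        by (intro lincomb_cong) auto
      then show ?thesis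
        using eM r by simp
    qed
    moreover have "r(k := \<zero>) \<in> UNIV \<rightarrow> carrier R"
      using r by (auto simp: Pi_iff)
    ultimately show ?thesis
      using ind[of "r(k := \<zero>)"] by (auto simp: less_Suc_eq)
  qed
  then have "independent_mod R M (\<lambda>_. P) e k"
    using eM by (auto simp: independent_mod_def)
  moreover have "p \<odot>\<^bsub>M\<^esub> e k = \<zero>\<^bsub>M\<^esub>"
  proof -
    have "lincomb M (\<lambda>i. if i = k then p else \<zero>) e (Suc k) = p \<odot>\<^bsub>M\<^esub> e k"
      using eM by (intro lincomb_single) auto
    moreover have "p \<in> P"
      using in_PI[of \<one>] by simp
    ultimately show ?thesis
      using ind[of "\<lambda>i. if i = k then p else \<zero>"] by auto
  qed
  moreover have "e k \<notin> span_of R M e k"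
  proof
    assume "e k \<in> span_of R M e k"
    then obtain r where r: "r \<in> UNIV \<rightarrow> carrier R" "e k = lincomb M r e k"
      by (rule span_ofE)
    \<comment> \<open>If e k were a combination of its predecessors, the coefficient -1 at k would lie in P.\<close>
    have "lincomb M (r(k := \<ominus> \<one>)) e k = lincomb M r e k"
      by (intro lincomb_cong) auto
    then have "lincomb M (r(k := \<ominus> \<one>)) e (Suc k) = e k \<oplus>\<^bsub>M\<^esub> (\<ominus> \<one>) \<odot>\<^bsub>M\<^esub> e k"
      by (simp flip: r(2))
    then have "lincomb M (r(k := \<ominus> \<one>)) e (Suc k) = \<zero>\<^bsub>M\<^esub>"
      using eM[of k] by (simp add: smult_l_minus M.r_neg)
    moreover have "r(k := \<ominus> \<one>) \<in> UNIV \<rightarrow> carrier R"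
      using r by (auto simp: Pi_iff)
    ultimately have "\<ominus> \<one> \<in> P"
      using ind[of "r(k := \<ominus> \<one>)"] by auto
    then have "\<one> \<in> P"
      using a_inv_closed[of "\<ominus> \<one>"] by simp
    then show False
      using one_imp_carrier I_notcarr by auto
  qed
  ultimately show ?R
    using eM by auto
next
  assume R: ?R
  then have eM: "\<And>i. i < Suc k \<Longrightarrow> e i \<in> carrier M"
    and ind: "\<And>r. r \<in> UNIV \<rightarrow> carrier R \<Longrightarrow>
      lincomb M r e k = \<zero>\<^bsub>M\<^esub> \<longleftrightarrow> (\<forall>i<k. r i \<in> P)"
    by (auto simp: independent_mod_def less_Suc_eq)
  have smult_P: "a \<odot>\<^bsub>M\<^esub> e k = \<zero>\<^bsub>M\<^esub>" if a: "a \<in> P" for a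
  proof -
    obtain s where "s \<in> carrier R" "a = s \<otimes> p"
      using a by (rule in_PE)
    then show ?thesis
      using R by (simp add: smult_assoc1)
  qed
  have "lincomb M r e (Suc k) = \<zero>\<^bsub>M\<^esub> \<longleftrightarrow> (\<forall>i<Suc k. r i \<in> P)" if r: "r \<in> UNIV \<rightarrow> carrier R" for r
  proof
    assume zero: "lincomb M r e (Suc k) = \<zero>\<^bsub>M\<^esub>"
    have rk: "r k \<in> carrier R"
      using r by auto
    have "r k \<in> P"
    proof (rule ccontr)
      assume "r k \<notin> P"
      then obtain s where s: "s \<in> carrier R" "s \<otimes> r k \<ominus> \<one> \<in> P"
        using rk inverse_mod_P by blast
      \<comment> \<open>Since P kills e k, the scalar s r k acts on it as 1, so multiplying the relation by s exhibits e k as a combination of its predecessors.\<close>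
      have "\<one> \<oplus> (s \<otimes> r k \<ominus> \<one>) = s \<otimes> r k"
        using s(1) rk by algebra
      then have "(s \<otimes> r k) \<odot>\<^bsub>M\<^esub> e k = \<one> \<odot>\<^bsub>M\<^esub> e k \<oplus>\<^bsub>M\<^esub> (s \<otimes> r k \<ominus> \<one>) \<odot>\<^bsub>M\<^esub> e k"
        using smult_l_distr[of \<one> "s \<otimes> r k \<ominus> \<one>" "e k"] s rk eM by simp
      then have ek: "s \<odot>\<^bsub>M\<^esub> (r k \<odot>\<^bsub>M\<^esub> e k) = e k"
        using smult_P[OF s(2)] s rk eM by (simp add: smult_assoc1)
      have "r k \<odot>\<^bsub>M\<^esub> e k = \<ominus>\<^bsub>M\<^esub> lincomb M r e k"
        using zero r rk eM M.minus_equality[of "r k \<odot>\<^bsub>M\<^esub> e k" "lincomb M r e k"]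
        by (simp add: M.a_comm)
      moreover have sub: "submodule (span_of R M e k) R M"
        using eM by (intro span_of_submodule) auto
      ultimately have "s \<odot>\<^bsub>M\<^esub> (r k \<odot>\<^bsub>M\<^esub> e k) \<in> span_of R M e k"
        using submoduleE(4)[OF sub s(1) submoduleE(3)[OF sub span_ofI[OF r]]] by simp
      then show False
        using ek R by simp
    qed
    moreover have "lincomb M r e k = \<zero>\<^bsub>M\<^esub>"
      using zero smult_P[OF \<open>r k \<in> P\<close>] r eM by simp
    ultimately show "\<forall>i<Suc k. r i \<in> P"
      using ind[OF r] by (simp add: less_Suc_eq)
  next
    assume "\<forall>i<Suc k. r i \<in> P"
    then show "lincomb M r e (Suc k) = \<zero>\<^bsub>M\<^esub>"
      using ind[OF r] smult_P[of "r k"] by simp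
  qed
  then show ?L
    using eM by (auto simp: independent_mod_def)
qed

lemma socle_independent_prefix:
  "j \<le> k \<Longrightarrow> independent_mod R M (\<lambda>_. P) e k \<Longrightarrow> independent_mod R M (\<lambda>_. P) e j"
  by (induction k rule: dec_induct) (auto simp: socle_independent_Suc)

lemma socle_independent_killed:
  assumes "independent_mod R M (\<lambda>_. P) e k" "i < k"
  shows "p \<odot>\<^bsub>M\<^esub> e i = \<zero>\<^bsub>M\<^esub>"
  using socle_independent_prefix[of "Suc i" k e] assms by (simp add: socle_independent_Suc)

text \<open>A homomorphism out of a direct sum of cyclic modules is injective as soon as it is injective on the
socle. The concrete reason: given a relation between the f i, multiply it by a power of p that is
large enough to push all coefficients into the ideals P^(\<mu> i), and then remove the factors p one by one.
At each stage the relation is one between socle vectors, so their independence gives back the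
factor p that was removed.\<close>

lemma independent_iff_socle:
  assumes \<mu>: "\<And>i. i < k \<Longrightarrow> 0 < \<mu> i"
  shows "independent_mod R M (\<lambda>i. Ppow (\<mu> i)) f k \<longleftrightarrow> (\<forall>i<k. f i \<in> carrier M) \<and>
    independent_mod R M (\<lambda>_. P) (\<lambda>i. p [^] (\<mu> i - 1) \<odot>\<^bsub>M\<^esub> f i) k"
    (is "?L \<longleftrightarrow> _ \<and> independent_mod R M _ ?e k")
proof (cases "\<forall>i<k. f i \<in> carrier M")
  case False
  then show ?thesis
    by (auto simp: independent_mod_def)
next
  case True
  then have fM: "\<And>i. i < k \<Longrightarrow> f i \<in> carrier M"
    by auto
  have lincomb_e: "lincomb M r ?e k = lincomb M (\<lambda>i. r i \<otimes> p [^] (\<mu> i - 1)) f k"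
    if "r \<in> UNIV \<rightarrow> carrier R" for r
    using that fM by (intro lincomb_scale_vectors) auto
  have Ppow_iff: "r \<otimes> p [^] (\<mu> i - 1) \<in> Ppow (\<mu> i) \<longleftrightarrow> r \<in> P" if "r \<in> carrier R" "i < k" for r i
    using mult_power_in_Ppow_Suc_iff[of r "\<mu> i - 1"] \<mu>[OF that(2)] that by simp
  show ?thesis
  proof (intro iffI conjI)
    assume L: ?L
    have "lincomb M r ?e k = \<zero>\<^bsub>M\<^esub> \<longleftrightarrow> (\<forall>i<k. r i \<in> P)" if r: "r \<in> UNIV \<rightarrow> carrier R" for r
    proof -
      \<comment> \<open>A relation between the socle vectors is one between the f i with coefficients multiplied by powers of p.\<close>
      have "(\<lambda>i. r i \<otimes> p [^] (\<mu> i - 1)) \<in> UNIV \<rightarrow> carrier R"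
        using r by auto
      then show ?thesis
        unfolding lincomb_e[OF r] using L Ppow_iff r by (auto simp: independent_mod_def Pi_iff)
    qed
    then show "independent_mod R M (\<lambda>_. P) ?e k"
      using fM by (auto simp: independent_mod_def)
  next
    assume "(\<forall>i<k. f i \<in> carrier M) \<and> independent_mod R M (\<lambda>_. P) ?e k"
    then have socle: "independent_mod R M (\<lambda>_. P) ?e k"
      by simp
    have descend: "\<forall>i<k. r i \<in> Ppow (\<mu> i)"
      if "r \<in> UNIV \<rightarrow> carrier R" "lincomb M r f k = \<zero>\<^bsub>M\<^esub>" "\<forall>i<k. p [^] (m::nat) \<otimes> r i \<in> Ppow (\<mu> i)" for r m
      using that(3)
    proof (induction m)
      case 0
      then show ?case
        using that(1) by (auto simp: Pi_iff)
    next
      case (Suc m)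
      have r: "r i \<in> carrier R" for i
        using that(1) by auto
      have "\<exists>s. s \<in> carrier R \<and> (i < k \<longrightarrow> p [^] m \<otimes> r i = s \<otimes> p [^] (\<mu> i - 1))" for i
      proof (cases "i < k")
        case True
        have "p \<otimes> (p [^] m \<otimes> r i) = p [^] Suc m \<otimes> r i"
          using r by (simp add: m_ac)
        then have "p [^] m \<otimes> r i \<in> Ppow (\<mu> i - 1)"
          using Ppow_cancel_generator[of "p [^] m \<otimes> r i" "\<mu> i - 1"] Suc.prems True \<mu>[OF True] r by simp
        then show ?thesis
          using in_PpowE by metis
      qed auto
      then obtain s where s: "\<And>i. s i \<in> carrier R"
        and s_eq: "\<And>i. i < k \<Longrightarrow> p [^] m \<otimes> r i = s i \<otimes> p [^] (\<mu> i - 1)"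
        by metis
      have "lincomb M s ?e k = lincomb M (\<lambda>i. p [^] m \<otimes> r i) f k"
        using s by (subst lincomb_e) (auto intro!: lincomb_cong simp: s_eq)
      also have "\<dots> = p [^] m \<odot>\<^bsub>M\<^esub> lincomb M r f k"
        using that(1) fM by (intro lincomb_smult) auto
      also have "\<dots> = \<zero>\<^bsub>M\<^esub>"
        using that(2) by simp
      finally have "s i \<in> P" if "i < k" for i
        using socle s that by (auto simp: independent_mod_def)
      then have "\<forall>i<k. p [^] m \<otimes> r i \<in> Ppow (\<mu> i)"
        using s_eq Ppow_iff s by auto
      then show ?case
        by (rule Suc.IH)
    qed
    \<comment> \<open>Any exponent that is at least every order would do to start the descent; the sum of the orders is one.\<close>
    have start: "p [^] sum \<mu> {..<k} \<otimes> a \<in> Ppow (\<mu> i)" if "a \<in> carrier R" "i < k" for a i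
    proof -
      have "\<mu> i \<le> sum \<mu> {..<k}"
        using that by (intro member_le_sum) auto
      then have "p [^] sum \<mu> {..<k} = p [^] (sum \<mu> {..<k} - \<mu> i) \<otimes> p [^] \<mu> i"
        by (simp add: nat_pow_mult)
      then have "p [^] sum \<mu> {..<k} \<otimes> a = (p [^] (sum \<mu> {..<k} - \<mu> i) \<otimes> a) \<otimes> p [^] \<mu> i"
        using that by (simp add: m_ac)
      then show ?thesis
        using in_PpowI[of "p [^] (sum \<mu> {..<k} - \<mu> i) \<otimes> a" "\<mu> i"] that by simp
    qed
    have "\<forall>i<k. r i \<in> Ppow (\<mu> i)"
      if "r \<in> UNIV \<rightarrow> carrier R" "lincomb M r f k = \<zero>\<^bsub>M\<^esub>" for r
      using descend[OF that, of "sum \<mu> {..<k}"] start that(1) by (simp add: Pi_iff)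
    moreover have "lincomb M r f k = \<zero>\<^bsub>M\<^esub>"
      if "r \<in> UNIV \<rightarrow> carrier R" and r: "\<forall>i<k. r i \<in> Ppow (\<mu> i)" for r
    proof (rule lincomb_zero)
      fix i assume i: "i < k"
      then obtain s where s: "s \<in> carrier R" "r i = s \<otimes> p [^] \<mu> i"
        using r in_PpowE by metis
      moreover have "p [^] \<mu> i = p \<otimes> p [^] (\<mu> i - 1)"
        using \<mu>[OF i] by (cases "\<mu> i") (auto simp: m_ac)
      ultimately show "r i \<odot>\<^bsub>M\<^esub> f i = \<zero>\<^bsub>M\<^esub>"
        using socle_independent_killed[OF socle i] fM[OF i] by (simp add: smult_assoc1)
    qed
    ultimately show ?L
      using fM unfolding independent_mod_def by blast
  qed (use fM in auto)
qed

section \<open>Torsion submodules\<close>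

text \<open>The span is a vector space of dimension k over the residue field: it is isomorphic to the direct
sum of k copies of R / P.\<close>

lemma card_span_socle_independent:
  assumes e: "independent_mod R M (\<lambda>_. P) e k"
  shows "card (span_of R M e k) = q ^ k"
proof -
  let ?S = "span_of R M e k" and ?Q = "finite_direct_sum {..<k} (\<lambda>_. quotient_module R P)"
  have sub: "submodule ?S R M"
    using e by (intro span_of_submodule) (auto simp: independent_mod_def)
  interpret S: module R "M\<lparr>carrier := ?S\<rparr>"
    using submodule.submodule_is_module[OF sub module_axioms] .
  have "e i \<in> ?S" if "i < k" for i
    using e that by (intro generator_in_span) (auto simp: independent_mod_def)
  then have "independent_mod R (M\<lparr>carrier := ?S\<rparr>) (\<lambda>_. P) e k"
    using e by (auto simp: independent_mod_def lincomb_carrier_update)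
  moreover have "span_of R (M\<lparr>carrier := ?S\<rparr>) e k = carrier (M\<lparr>carrier := ?S\<rparr>)"
    by (simp add: span_of_def lincomb_carrier_update)
  ultimately have "module_iso R (M\<lparr>carrier := ?S\<rparr>) ?Q \<noteq> {}"
    using is_ideal by (intro S.iso_quotient_sum_if_basis)
  then have "card ?S = card (carrier ?Q)"
    using card_eq_if_module_iso by fastforce
  also have "carrier ?Q = (\<Pi>\<^sub>E i\<in>{..<k}. carrier (R Quot P))"
    by (simp add: quotient_sum_carrier[where I = "\<lambda>_. P"] is_ideal FactRing_def)
  also have "card \<dots> = q ^ k"
    by (simp add: card_PiE q_def)
  finally show ?thesis .
qed

definition torsion :: "nat \<Rightarrow> 'c set"
  where "torsion m = {x \<in> carrier M. p [^] m \<odot>\<^bsub>M\<^esub> x = \<zero>\<^bsub>M\<^esub>}"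

lemma smult_power_add:
  "x \<in> carrier M \<Longrightarrow> p [^] (m + n) \<odot>\<^bsub>M\<^esub> x = p [^] m \<odot>\<^bsub>M\<^esub> (p [^] n \<odot>\<^bsub>M\<^esub> x)" for m n :: nat
  by (simp add: smult_assoc1 flip: nat_pow_mult)

lemma finite_torsion: "finite (torsion m)"
  using finite_module by (simp add: torsion_def)

lemma card_torsion_0: "card (torsion 0) = 1"
proof -
  have "torsion 0 = {\<zero>\<^bsub>M\<^esub>}"
    by (auto simp: torsion_def)
  then show ?thesis
    by simp
qed

lemma span_of_multiples:
  assumes e: "\<And>i. i < j \<Longrightarrow> \<exists>g\<in>carrier M. e i = a \<odot>\<^bsub>M\<^esub> g" and a: "a \<in> carrier R"
  shows "span_of R M e j \<subseteq> (\<lambda>x. a \<odot>\<^bsub>M\<^esub> x) ` carrier M"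
proof
  fix x assume "x \<in> span_of R M e j"
  then obtain r where r: "r \<in> UNIV \<rightarrow> carrier R" "x = lincomb M r e j"
    by (rule span_ofE)
  obtain g where g: "\<And>i. i < j \<Longrightarrow> g i \<in> carrier M \<and> e i = a \<odot>\<^bsub>M\<^esub> g i"
    using e by metis
  have "x = lincomb M (\<lambda>i. a \<otimes> r i) g j"
    unfolding r(2) using g r(1) a by (intro lincomb_cong) (auto simp: Pi_iff smult_assoc1[symmetric] m_comm)
  also have "\<dots> = a \<odot>\<^bsub>M\<^esub> lincomb M r g j"
    using g r(1) a by (intro lincomb_smult) auto
  finally show "x \<in> (\<lambda>x. a \<odot>\<^bsub>M\<^esub> x) ` carrier M"
    using g r(1) by auto
qed

lemma socle_span_killed:
  assumes e: "independent_mod R M (\<lambda>_. P) e j" and x: "x \<in> span_of R M e j"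
  shows "p \<odot>\<^bsub>M\<^esub> x = \<zero>\<^bsub>M\<^esub>"
proof -
  obtain r where r: "r \<in> UNIV \<rightarrow> carrier R" "x = lincomb M r e j"
    using x by (rule span_ofE)
  have eM: "\<And>i. i < j \<Longrightarrow> e i \<in> carrier M"
    using e by (auto simp: independent_mod_def)
  have "p \<odot>\<^bsub>M\<^esub> x = lincomb M (\<lambda>i. p \<otimes> r i) e j"
    using r eM by (simp add: lincomb_smult)
  also have "\<dots> = \<zero>\<^bsub>M\<^esub>"
    using r(1) eM socle_independent_killed[OF e]
    by (intro lincomb_zero) (auto simp: Pi_iff m_comm[of p] smult_assoc1)
  finally show ?thesis .
qed

text \<open>If every e i is divisible by p^m, so is its whole span, and all the fibers over that span are
translates of the p^m-torsion.\<close>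

lemma card_vimage_power:
  assumes e: "independent_mod R M (\<lambda>_. P) e j"
    and div: "\<And>i. i < j \<Longrightarrow> \<exists>g\<in>carrier M. e i = p [^] m \<odot>\<^bsub>M\<^esub> g"
  shows "card {x \<in> carrier M. p [^] m \<odot>\<^bsub>M\<^esub> x \<in> span_of R M e j} = card (torsion m) * q ^ j"
    and "{x \<in> carrier M. p [^] m \<odot>\<^bsub>M\<^esub> x \<in> span_of R M e j} \<subseteq> torsion (Suc m)"
proof -
  show "card {x \<in> carrier M. p [^] m \<odot>\<^bsub>M\<^esub> x \<in> span_of R M e j} = card (torsion m) * q ^ j"
    using card_vimage_smult[OF finite_module _ span_of_multiples[OF div]]
      card_span_socle_independent[OF e] by (simp add: torsion_def)
  have "p [^] Suc m \<odot>\<^bsub>M\<^esub> x = \<zero>\<^bsub>M\<^esub>"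
    if "x \<in> carrier M" "p [^] m \<odot>\<^bsub>M\<^esub> x \<in> span_of R M e j" for x
    using socle_span_killed[OF e that(2)] that(1) by (simp add: m_comm[of _ p] smult_assoc1)
  then show "{x \<in> carrier M. p [^] m \<odot>\<^bsub>M\<^esub> x \<in> span_of R M e j} \<subseteq> torsion (Suc m)"
    by (auto simp: torsion_def)
qed

text \<open>Multiplication by p^m maps the p^(m + 1)-torsion onto the part of the socle that is divisible by p^m. In
terms of a basis g with decreasing orders \<mu>, that part is spanned by the socle vectors of those j
basis elements whose order exceeds m.\<close>

lemma card_torsion_Suc:
  assumes g: "independent_mod R M (\<lambda>i. Ppow (\<mu> i)) g l"
    and span: "span_of R M g l = carrier M"
    and pos: "\<And>i. i < l \<Longrightarrow> 0 < \<mu> i"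
    and j: "j \<le> l" "\<And>i. i < l \<Longrightarrow> m < \<mu> i \<longleftrightarrow> i < j"
  shows "card (torsion (Suc m)) = card (torsion m) * q ^ j"
proof -
  let ?e = "\<lambda>i. p [^] (\<mu> i - 1) \<odot>\<^bsub>M\<^esub> g i"
  have gM: "\<And>i. i < l \<Longrightarrow> g i \<in> carrier M" and "independent_mod R M (\<lambda>_. P) ?e l"
    using g independent_iff_socle[OF pos] by auto
  then have e: "independent_mod R M (\<lambda>_. P) ?e j"
    using j(1) by (intro socle_independent_prefix[of j l])
  have div: "\<exists>y\<in>carrier M. ?e i = p [^] m \<odot>\<^bsub>M\<^esub> y" if "i < j" for i
  proof -
    have "m < \<mu> i"
      using j(1) j(2)[of i] that by simp
    then have "?e i = p [^] m \<odot>\<^bsub>M\<^esub> (p [^] (\<mu> i - 1 - m) \<odot>\<^bsub>M\<^esub> g i)"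
      using smult_power_add[of "g i" m "\<mu> i - 1 - m"] gM[of i] j(1) that by simp
    then show ?thesis
      using gM[of i] j(1) that by auto
  qed
  have "torsion (Suc m) \<subseteq> {x \<in> carrier M. p [^] m \<odot>\<^bsub>M\<^esub> x \<in> span_of R M ?e j}"
  proof
    fix x assume x: "x \<in> torsion (Suc m)"
    then have xM: "x \<in> carrier M"
      by (simp add: torsion_def)
    then obtain r where r: "r \<in> UNIV \<rightarrow> carrier R" "x = lincomb M r g l"
      using span span_ofE[of x R M g l] by metis
    have rR: "r i \<in> carrier R" for i
      using r by auto
    have "lincomb M (\<lambda>i. p [^] Suc m \<otimes> r i) g l = \<zero>\<^bsub>M\<^esub>"
      using x r gM lincomb_smult[of "p [^] Suc m" r l g] by (simp add: torsion_def)
    then have "\<forall>i<l. p [^] Suc m \<otimes> r i \<in> Ppow (\<mu> i)"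
      using g rR by (auto simp: independent_mod_def Pi_iff)
    then have Ppow: "p \<otimes> (p [^] m \<otimes> r i) \<in> Ppow (\<mu> i)" if "i < l" for i
      using rR that by (simp add: m_ac)
    have "\<exists>s. s \<in> carrier R \<and> (i < j \<longrightarrow> p [^] m \<otimes> r i = s \<otimes> p [^] (\<mu> i - 1))" for i
    proof (cases "i < j")
      case True
      then have "p [^] m \<otimes> r i \<in> Ppow (\<mu> i - 1)"
        using Ppow_cancel_generator[of "p [^] m \<otimes> r i" "\<mu> i - 1"] Ppow[of i] pos[of i] j(1) rR by simp
      then show ?thesis
        using in_PpowE by metis
    qed auto
    then obtain s where s: "\<And>i. s i \<in> carrier R"
      and s_eq: "\<And>i. i < j \<Longrightarrow> p [^] m \<otimes> r i = s i \<otimes> p [^] (\<mu> i - 1)"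
      by metis
    \<comment> \<open>A basis element of order at most m contributes nothing to a p^m-multiple.\<close>
    have vanish: "(p [^] m \<otimes> r i) \<odot>\<^bsub>M\<^esub> g i = \<zero>\<^bsub>M\<^esub>" if "i < l" "\<not> i < j" for i
    proof -
      have "\<mu> i \<le> m"
        using j(2)[of i] that by simp
      then have "p [^] m = p [^] (m - \<mu> i) \<otimes> p [^] \<mu> i"
        by (simp add: nat_pow_mult)
      then have "p [^] m \<otimes> r i = (p [^] (m - \<mu> i) \<otimes> r i) \<otimes> p [^] \<mu> i"
        using rR by (simp add: m_ac)
      then have "p [^] m \<otimes> r i \<in> Ppow (\<mu> i)"
        using in_PpowI[of "p [^] (m - \<mu> i) \<otimes> r i" "\<mu> i"] rR by simp
      then have "\<forall>n<l. (if n = i then p [^] m \<otimes> r i else \<zero>) \<in> Ppow (\<mu> n)"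
        by (simp add: additive_subgroup.zero_closed ideal.axioms(1) cgenideal_ideal)
      then have "lincomb M (\<lambda>n. if n = i then p [^] m \<otimes> r i else \<zero>) g l = \<zero>\<^bsub>M\<^esub>"
        using g rR by (auto simp: independent_mod_def)
      then show ?thesis
        using lincomb_single[of "p [^] m \<otimes> r i" i l g] that gM rR by simp
    qed
    have prefix: "lincomb M (\<lambda>i. p [^] m \<otimes> r i) g n = lincomb M (\<lambda>i. p [^] m \<otimes> r i) g j"
      if "j \<le> n" "n \<le> l" for n
      using that
    proof (induction n rule: dec_induct)
      case (step n)
      then show ?case
        using vanish[of n] gM rR by simp
    qed simp
    have "p [^] m \<odot>\<^bsub>M\<^esub> x = lincomb M (\<lambda>i. p [^] m \<otimes> r i) g l"
      using r gM by (simp add: lincomb_smult)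
    also have "\<dots> = lincomb M (\<lambda>i. p [^] m \<otimes> r i) g j"
      using j(1) by (intro prefix) auto
    also have "\<dots> = lincomb M s ?e j"
      using gM s j(1) by (intro lincomb_cong) (simp add: s_eq smult_assoc1)
    finally show "x \<in> {x \<in> carrier M. p [^] m \<odot>\<^bsub>M\<^esub> x \<in> span_of R M ?e j}"
      using xM s span_ofI[of s R M ?e j] by auto
  qed
  then have "torsion (Suc m) = {x \<in> carrier M. p [^] m \<odot>\<^bsub>M\<^esub> x \<in> span_of R M ?e j}"
    using card_vimage_power(2)[OF e div] by blast
  then show ?thesis
    using card_vimage_power(1)[OF e div] by simp
qed

section \<open>Counting independent families\<close>

text \<open>Families are extensional outside their k indices, so that only finitely many exist and extending a
family by one vector is a bijection onto pairs.\<close>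

definition families :: "(nat \<Rightarrow> nat) \<Rightarrow> nat \<Rightarrow> (nat \<Rightarrow> 'c) set"
  where "families \<mu> k = {f \<in> {..<k} \<rightarrow>\<^sub>E carrier M. independent_mod R M (\<lambda>i. Ppow (\<mu> i)) f k}"

lemma finite_families: "finite (families \<mu> k)"
proof (rule finite_subset)
  show "families \<mu> k \<subseteq> {..<k} \<rightarrow>\<^sub>E carrier M"
    by (auto simp: families_def)
  show "finite ({..<k} \<rightarrow>\<^sub>E carrier M)"
    using finite_module by (simp add: finite_PiE)
qed

text \<open>A family of length k is extended by an x killed by p^(\<mu> k) whose socle vector avoids the span of the earlier
ones. The earlier orders are at least \<mu> k, so that span is divisible by p^(\<mu> k - 1) and the number of
forbidden x is the same for every family. The equation is stated over the rationals to keep the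
subtraction from being truncated.\<close>

lemma card_families_Suc:
  assumes pos: "\<And>i. i \<le> k \<Longrightarrow> 0 < \<mu> i" and mono: "\<And>i. i \<le> k \<Longrightarrow> \<mu> k \<le> \<mu> i"
  shows "rat_of_nat (card (families \<mu> (Suc k))) = of_nat (card (families \<mu> k)) *
    (of_nat (card (torsion (\<mu> k))) - of_nat (card (torsion (\<mu> k - 1))) * of_nat q ^ k)"
proof -
  define socle where "socle f = (\<lambda>i. p [^] (\<mu> i - 1) \<odot>\<^bsub>M\<^esub> f i)" for f :: "nat \<Rightarrow> 'c"
  define extension_set where "extension_set f = {x \<in> torsion (\<mu> k). p [^] (\<mu> k - 1) \<odot>\<^bsub>M\<^esub> x \<notin> span_of R M (socle f) k}" for f
  let ?bad = "\<lambda>f. {x \<in> carrier M. p [^] (\<mu> k - 1) \<odot>\<^bsub>M\<^esub> x \<in> span_of R M (socle f) k}"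
  have families_iff: "f \<in> families \<mu> n \<longleftrightarrow> f \<in> {..<n} \<rightarrow>\<^sub>E carrier M \<and> independent_mod R M (\<lambda>_. P) (socle f) n"
    if "n \<le> Suc k" for f n
    using independent_iff_socle[of n \<mu> f] pos that
    by (auto simp: families_def socle_def)
  have mu_k: "p [^] \<mu> k = p \<otimes> p [^] (\<mu> k - 1)"
    using pos[of k] by (cases "\<mu> k") (auto simp: m_ac)
  have bad: "card (?bad f) = card (torsion (\<mu> k - 1)) * q ^ k \<and> ?bad f \<subseteq> torsion (\<mu> k)"
    if f: "f \<in> families \<mu> k" for f
  proof -
    have "\<exists>y\<in>carrier M. socle f i = p [^] (\<mu> k - 1) \<odot>\<^bsub>M\<^esub> y" if "i < k" for i
    proof -
      have fi: "f i \<in> carrier M"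
        using f that by (auto simp: families_def)
      have "\<mu> i - 1 = (\<mu> k - 1) + (\<mu> i - \<mu> k)"
        using mono[of i] pos[of k] that by simp
      then have "socle f i = p [^] (\<mu> k - 1) \<odot>\<^bsub>M\<^esub> (p [^] (\<mu> i - \<mu> k) \<odot>\<^bsub>M\<^esub> f i)"
        unfolding socle_def using smult_power_add[OF fi] by simp
      then show ?thesis
        using fi by auto
    qed
    moreover have "independent_mod R M (\<lambda>_. P) (socle f) k"
      using f families_iff by simp
    ultimately show ?thesis
      using card_vimage_power[of "socle f" k "\<mu> k - 1"] pos[of k] by simp
  qed
  have card_X: "card (extension_set f) = card (torsion (\<mu> k)) - card (torsion (\<mu> k - 1)) * q ^ k"
    if f: "f \<in> families \<mu> k" for f
  proof -
    have "extension_set f = torsion (\<mu> k) - ?bad f"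
      by (auto simp: extension_set_def torsion_def)
    moreover have "?bad f \<subseteq> torsion (\<mu> k)" "finite (?bad f)"
      using bad[OF f] finite_module by simp_all
    ultimately have "card (extension_set f) = card (torsion (\<mu> k)) - card (?bad f)"
      by (simp only: card_Diff_subset)
    then show ?thesis
      using bad[OF f] by simp
  qed
  have ext: "f(k := x) \<in> families \<mu> (Suc k) \<longleftrightarrow> f \<in> families \<mu> k \<and> x \<in> extension_set f"
    if f: "f \<in> {..<k} \<rightarrow>\<^sub>E carrier M" and x: "x \<in> carrier M" for f x
  proof -
    have "f(k := x) \<in> {..<Suc k} \<rightarrow>\<^sub>E carrier M"
      using f x by (auto simp: lessThan_Suc PiE_iff extensional_def)
    moreover have "lincomb M r (socle (f(k := x))) k = lincomb M r (socle f) k" for r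
      by (intro lincomb_cong) (auto simp: socle_def)
    then have "independent_mod R M (\<lambda>_. P) (socle (f(k := x))) k \<longleftrightarrow>
        independent_mod R M (\<lambda>_. P) (socle f) k"
      "span_of R M (socle (f(k := x))) k = span_of R M (socle f) k"
      by (auto simp: independent_mod_def span_of_def socle_def)
    moreover have "socle (f(k := x)) k = p [^] (\<mu> k - 1) \<odot>\<^bsub>M\<^esub> x"
      by (simp add: socle_def)
    ultimately show ?thesis
      using f x by (auto simp: families_iff socle_independent_Suc extension_set_def torsion_def mu_k smult_assoc1)
  qed
  have "bij_betw (\<lambda>(f, x). f(k := x)) (SIGMA f : families \<mu> k. extension_set f) (families \<mu> (Suc k))"
  proof (rule bij_betw_imageI)
    show "inj_on (\<lambda>(f, x). f(k := x)) (SIGMA f : families \<mu> k. extension_set f)"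
    proof (rule inj_onI, clarify)
      fix f x f' x'
      assume "f \<in> families \<mu> k" "f' \<in> families \<mu> k" and eq: "f(k := x) = f'(k := x')"
      then have "f k = undefined" "f' k = undefined"
        by (auto simp: families_def PiE_iff extensional_def)
      then have "f = f'"
        using eq by (metis fun_upd_triv fun_upd_upd)
      moreover have "x = x'"
        using eq by (metis fun_upd_same)
      ultimately show "f = f' \<and> x = x'"
        by simp
    qed
    show "(\<lambda>(f, x). f(k := x)) ` (SIGMA f : families \<mu> k. extension_set f) = families \<mu> (Suc k)"
    proof (intro equalityI subsetI)
      fix g assume "g \<in> (\<lambda>(f, x). f(k := x)) ` (SIGMA f : families \<mu> k. extension_set f)"
      then obtain f x where "f \<in> families \<mu> k" "x \<in> extension_set f" "g = f(k := x)"
        by auto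
      moreover then have "f \<in> {..<k} \<rightarrow>\<^sub>E carrier M" "x \<in> carrier M"
        by (auto simp: families_def extension_set_def torsion_def)
      ultimately show "g \<in> families \<mu> (Suc k)"
        using ext by simp
    next
      fix g assume g: "g \<in> families \<mu> (Suc k)"
      then have gE: "g \<in> {..<Suc k} \<rightarrow>\<^sub>E carrier M"
        by (simp add: families_def)
      then have 1: "g(k := undefined) \<in> {..<k} \<rightarrow>\<^sub>E carrier M" "g k \<in> carrier M"
        by (auto simp: PiE_iff extensional_def)
      have "g = (g(k := undefined))(k := g k)"
        by simp
      then have "g(k := undefined) \<in> families \<mu> k \<and> g k \<in> extension_set (g(k := undefined))"
        using ext[OF 1] g by simp
      then show "g \<in> (\<lambda>(f, x). f(k := x)) ` (SIGMA f : families \<mu> k. extension_set f)"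
        by (intro image_eqI[of _ _ "(g(k := undefined), g k)"]) auto
    qed
  qed
  then have "card (families \<mu> (Suc k)) = card (SIGMA f : families \<mu> k. extension_set f)"
    by (rule bij_betw_same_card[symmetric])
  also have "\<dots> = (\<Sum>f\<in>families \<mu> k. card (extension_set f))"
    using finite_families finite_torsion by (intro card_SigmaI) (auto simp: extension_set_def)
  also have "\<dots> = card (families \<mu> k) * (card (torsion (\<mu> k)) - card (torsion (\<mu> k - 1)) * q ^ k)"
    using card_X by simp
  finally have card_eq: "card (families \<mu> (Suc k)) =
    card (families \<mu> k) * (card (torsion (\<mu> k)) - card (torsion (\<mu> k - 1)) * q ^ k)" .
  show ?thesis
  proof (cases "families \<mu> k = {}")
    case False
    then obtain f where f: "f \<in> families \<mu> k"
      by blast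
    then have "card (torsion (\<mu> k - 1)) * q ^ k \<le> card (torsion (\<mu> k))"
      using bad[OF f] card_mono[OF finite_torsion, of "?bad f" "\<mu> k"] by simp
    then show ?thesis
      unfolding card_eq by (simp add: of_nat_diff)
  qed (simp add: card_eq)
qed

section \<open>Counting submodules of a given type\<close>

text \<open>This turns the isomorphism hidden in a type into a basis with prescribed orders.\<close>

lemma has_type_iff_basis:
  "has_type R P M xs \<longleftrightarrow> (\<exists>f. independent_mod R M (\<lambda>i. Ppow (xs ! i)) f (length xs) \<and>
    span_of R M f (length xs) = carrier M)"
proof -
  have I: "ideal (Ppow (xs ! i)) R" for i
    by (simp add: cgenideal_ideal)
  show ?thesis
    unfolding has_type_def ideal_power
    using basis_if_iso_quotient_sum[of "length xs" "\<lambda>i. Ppow (xs ! i)", OF I]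
      iso_quotient_sum_if_basis[of "length xs" "\<lambda>i. Ppow (xs ! i)", OF I] by blast
qed

lemma card_torsion_of_type:
  assumes \<alpha>: "is_partition \<alpha>" and type: "has_type R P M (conjugate_partition \<alpha>)"
  shows "card (torsion m) = q ^ (\<Sum>j<m. nth_default 0 \<alpha> j)"
proof (induction m)
  case 0
  then show ?case
    by (simp add: card_torsion_0)
next
  case (Suc m)
  obtain g where g: "independent_mod R M (\<lambda>i. Ppow (conjugate_partition \<alpha> ! i)) g (nth_default 0 \<alpha> 0)"
    "span_of R M g (nth_default 0 \<alpha> 0) = carrier M"
    using type by (auto simp: has_type_iff_basis length_conjugate_partition)
  have "card (torsion (Suc m)) = card (torsion m) * q ^ nth_default 0 \<alpha> m"
    using less_conjugate_partition_iff[OF \<alpha>] partition_antimono[OF \<alpha>, of 0 m]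
    by (intro card_torsion_Suc[OF g]) auto
  then show ?case
    using Suc by (simp add: power_add)
qed

lemma card_families_of_type:
  assumes \<alpha>: "is_partition \<alpha>" and type: "has_type R P M (conjugate_partition \<alpha>)"
    and pos: "\<And>i. i < k \<Longrightarrow> 0 < \<mu> i" and mono: "\<And>i j. i \<le> j \<Longrightarrow> j < k \<Longrightarrow> \<mu> j \<le> \<mu> i"
  shows "rat_of_nat (card (families \<mu> k)) =
    (\<Prod>i<k. of_nat q ^ (\<Sum>j<\<mu> i - 1. nth_default 0 \<alpha> j) *
      (of_nat q ^ nth_default 0 \<alpha> (\<mu> i - 1) - of_nat q ^ i))"
  using pos mono
proof (induction k)
  case 0
  have "families \<mu> 0 = {\<lambda>_. undefined}"
    by (auto simp: families_def independent_mod_def)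
  then show ?case
    by simp
next
  case (Suc k)
  obtain m where m: "\<mu> k = Suc m"
    using Suc.prems(1)[of k] gr0_implies_Suc by blast
  have "rat_of_nat (card (families \<mu> (Suc k))) = of_nat (card (families \<mu> k)) *
    (of_nat (card (torsion (\<mu> k))) - of_nat (card (torsion (\<mu> k - 1))) * of_nat q ^ k)"
    using Suc.prems by (intro card_families_Suc) auto
  then show ?case
    using Suc by (simp add: card_torsion_of_type[OF \<alpha> type] m power_add algebra_simps)
qed

lemma residue_card_ge_2: "2 \<le> q"
proof -
  interpret K: field "R Quot P"
    by (rule quotient_is_field[OF R.is_cring])
  have "card {\<zero>\<^bsub>R Quot P\<^esub>, \<one>\<^bsub>R Quot P\<^esub>} \<le> q"
    unfolding q_def using finite_residues by (intro card_mono) auto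
  then show ?thesis
    using K.one_not_zero by simp
qed

lemma submodule_over_dvr:
  assumes "submodule N R M"
  shows "module_over_dvr R (M\<lparr>carrier := N\<rparr>) P p q"
proof -
  have "N \<subseteq> carrier M"
    using submoduleE(1)[OF assms] .
  then show ?thesis
    using submodule.submodule_is_module[OF assms module_axioms] discrete_valuation_ring_axioms
      P_eq finite_residues q_def finite_subset[OF _ finite_module]
    by (simp add: module_over_dvr_def module_over_dvr_axioms_def)
qed

lemma span_of_family_has_type:
  assumes f: "f \<in> families ((!) xs) (length xs)"
  shows "submodule (span_of R M f (length xs)) R M"
    and "has_type R P (M\<lparr>carrier := span_of R M f (length xs)\<rparr>) xs"
proof -
  let ?k = "length xs" and ?S = "span_of R M f (length xs)"
  have fM: "\<And>i. i < ?k \<Longrightarrow> f i \<in> carrier M"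
    and fI: "independent_mod R M (\<lambda>i. Ppow (xs ! i)) f ?k"
    using f by (auto simp: families_def)
  show S: "submodule ?S R M"
    using fM by (intro span_of_submodule) auto
  interpret S: module_over_dvr R "M\<lparr>carrier := ?S\<rparr>" P p q
    by (rule submodule_over_dvr[OF S])
  have "f i \<in> ?S" if "i < ?k" for i
    using that fM by (intro generator_in_span) auto
  then have "independent_mod R (M\<lparr>carrier := ?S\<rparr>) (\<lambda>i. Ppow (xs ! i)) f ?k"
    using fI by (auto simp: independent_mod_def lincomb_carrier_update)
  moreover have "span_of R (M\<lparr>carrier := ?S\<rparr>) f ?k = carrier (M\<lparr>carrier := ?S\<rparr>)"
    by (simp add: span_of_def lincomb_carrier_update)
  ultimately show "has_type R P (M\<lparr>carrier := ?S\<rparr>) xs"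
    using S.has_type_iff_basis by blast
qed

text \<open>A family inside N spans all of N, since its span has the same type as N and hence the same
number of elements. So the families with span N are exactly those that live in N, and the count
of families applies to N as a module in its own right.\<close>

lemma families_spanning_submodule:
  assumes N: "submodule N R M" and type: "has_type R P (M\<lparr>carrier := N\<rparr>) xs"
  shows "{f \<in> families ((!) xs) (length xs). span_of R M f (length xs) = N} =
    module_over_dvr.families R (M\<lparr>carrier := N\<rparr>) p ((!) xs) (length xs)"
proof -
  interpret N: module_over_dvr R "M\<lparr>carrier := N\<rparr>" P p q
    by (rule submodule_over_dvr[OF N])
  have NM: "N \<subseteq> carrier M"
    using submoduleE(1)[OF N] .
  have ind: "independent_mod R (M\<lparr>carrier := N\<rparr>) I f k \<longleftrightarrow> independent_mod R M I f k"
    if "f \<in> {..<k} \<rightarrow>\<^sub>E N" for I f k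
    using that NM by (auto simp: independent_mod_def lincomb_carrier_update)
  have span_N: "span_of R M f (length xs) = N" if f: "f \<in> N.families ((!) xs) (length xs)" for f
  proof -
    let ?k = "length xs" and ?S = "span_of R M f (length xs)"
    have fN: "f \<in> {..<?k} \<rightarrow>\<^sub>E N" and fI: "independent_mod R M (\<lambda>i. Ppow (xs ! i)) f ?k"
      using f ind by (auto simp: N.families_def)
    have SN: "?S \<subseteq> N"
      using fN by (intro span_of_subset_submodule[OF N]) auto
    have "has_type R P (M\<lparr>carrier := ?S\<rparr>) xs"
      using fN fI NM by (intro span_of_family_has_type) (auto simp: families_def PiE_iff)
    then have "card ?S = card N"
      using type by (auto simp: has_type_def dest!: card_eq_if_module_iso)
    then show ?thesis
      using SN finite_subset[OF NM finite_module] card_subset_eq by blast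
  qed
  show ?thesis
  proof (intro equalityI subsetI)
    fix f assume f: "f \<in> {f \<in> families ((!) xs) (length xs). span_of R M f (length xs) = N}"
    then have fM: "f \<in> {..<length xs} \<rightarrow>\<^sub>E carrier M"
      by (simp add: families_def)
    then have "f \<in> {..<length xs} \<rightarrow>\<^sub>E N"
      using f generator_in_span[of _ "length xs" f] by (auto simp: PiE_iff)
    then show "f \<in> N.families ((!) xs) (length xs)"
      using f ind by (simp add: families_def N.families_def)
  next
    fix f assume f: "f \<in> N.families ((!) xs) (length xs)"
    then have fN: "f \<in> {..<length xs} \<rightarrow>\<^sub>E N"
      by (simp add: N.families_def)
    then have "f \<in> {..<length xs} \<rightarrow>\<^sub>E carrier M"
      using NM by (auto simp: PiE_iff)
    then show "f \<in> {f \<in> families ((!) xs) (length xs). span_of R M f (length xs) = N}"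
      using f span_N[OF f] ind[OF fN] by (simp add: families_def N.families_def)
  qed
qed

text \<open>Grouping the families of M by their span gives the number of families in M as the number of
submodules of type \<beta>' times the number of families in one of them.\<close>

theorem card_submodules_of_type:
  assumes \<alpha>: "is_partition \<alpha>" and \<beta>: "is_partition \<beta>" and sub: "partition_subset \<beta> \<alpha>"
    and type: "has_type R P M (conjugate_partition \<alpha>)"
  shows "of_nat (card {N. submodule N R M \<and>
                          has_type R P (M\<lparr>carrier := N\<rparr>) (conjugate_partition \<beta>)}) =
    (\<Prod>i<length \<beta>.
       gauss_coeff (nth_default 0 \<alpha> i - nth_default 0 \<beta> (Suc i))
                   (nth_default 0 \<beta> i - nth_default 0 \<beta> (Suc i)) (of_nat q)
       * of_nat q ^ (nth_default 0 \<beta> (Suc i) * (nth_default 0 \<alpha> i - nth_default 0 \<beta> i)))"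
proof -
  let ?\<mu> = "(!) (conjugate_partition \<beta>)" and ?a = "nth_default 0 \<alpha>" and ?b = "nth_default 0 \<beta>"
  let ?k = "?b 0"
  define Subs where "Subs = {N. submodule N R M \<and> has_type R P (M\<lparr>carrier := N\<rparr>) (conjugate_partition \<beta>)}"
  define count :: "(nat \<Rightarrow> nat) \<Rightarrow> rat" where "count c = (\<Prod>i<?k. of_nat q ^ sum c {..<?\<mu> i - 1} *
    (of_nat q ^ c (?\<mu> i - 1) - of_nat q ^ i))" for c
  have \<mu>: "m < ?\<mu> i \<longleftrightarrow> i < ?b m" if "i < ?k" for i m
    using less_conjugate_partition_iff[OF \<beta> that] .
  have pos: "0 < ?\<mu> i" if "i < ?k" for i
    using \<mu>[OF that, of 0] that by simp
  have mono: "?\<mu> j \<le> ?\<mu> i" if "i \<le> j" "j < ?k" for i j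
  proof (rule ccontr)
    assume "\<not> ?\<mu> j \<le> ?\<mu> i"
    then show False
      using \<mu>[of j "?\<mu> i"] \<mu>[of i "?\<mu> i"] that by simp
  qed
  have count_M: "of_nat (card (families ?\<mu> ?k)) = count ?a"
    unfolding count_def by (intro card_families_of_type[OF \<alpha> type] pos mono)
  have count_N: "of_nat (card {f \<in> families ?\<mu> ?k. span_of R M f ?k = N}) = count ?b"
    if "N \<in> Subs" for N
  proof -
    have N: "submodule N R M" "has_type R P (M\<lparr>carrier := N\<rparr>) (conjugate_partition \<beta>)"
      using that by (auto simp: Subs_def)
    interpret N: module_over_dvr R "M\<lparr>carrier := N\<rparr>" P p q
      by (rule submodule_over_dvr[OF N(1)])
    have "of_nat (card (N.families ?\<mu> ?k)) = count ?b"
      unfolding count_def by (intro N.card_families_of_type[OF \<beta> N(2)] pos mono)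
    then show ?thesis
      using families_spanning_submodule[OF N] by (simp add: length_conjugate_partition)
  qed
  have "Subs \<subseteq> Pow (carrier M)"
    using submoduleE(1) by (auto simp: Subs_def)
  then have "finite Subs"
    using finite_module by (simp add: finite_subset)
  have "families ?\<mu> ?k = (\<Union>N\<in>Subs. {f \<in> families ?\<mu> ?k. span_of R M f ?k = N})"
    using span_of_family_has_type[of _ "conjugate_partition \<beta>"]
    by (auto simp: Subs_def length_conjugate_partition)
  then have "card (families ?\<mu> ?k) = card (\<Union>N\<in>Subs. {f \<in> families ?\<mu> ?k. span_of R M f ?k = N})"
    by simp
  also have "\<dots> = (\<Sum>N\<in>Subs. card {f \<in> families ?\<mu> ?k. span_of R M f ?k = N})"
    using \<open>finite Subs\<close> finite_families by (intro card_UN_disjoint) auto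
  finally have "rat_of_nat (card (families ?\<mu> ?k)) =
      (\<Sum>N\<in>Subs. of_nat (card {f \<in> families ?\<mu> ?k. span_of R M f ?k = N}))"
    by simp
  also have "\<dots> = of_nat (card Subs) * count ?b"
    using count_N by simp
  finally have total: "count ?a = of_nat (card Subs) * count ?b"
    using count_M by simp
  have "count ?b \<noteq> 0"
  proof -
    \<comment> \<open>The denominator does not vanish because i < \<beta> m for m = \<mu> i - 1, which lies below \<mu> i.\<close>
    have "rat_of_nat q ^ ?b (?\<mu> i - 1) \<noteq> of_nat q ^ i" if "i < ?k" for i
    proof -
      have "i < ?b (?\<mu> i - 1)"
        using \<mu>[OF that, of "?\<mu> i - 1"] pos[OF that] by simp
      then have "rat_of_nat q ^ i < of_nat q ^ ?b (?\<mu> i - 1)"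
        using residue_card_ge_2 by (intro power_strict_increasing) auto
      then show ?thesis
        by simp
    qed
    then show ?thesis
      using residue_card_ge_2 by (simp add: count_def)
  qed
  then have "of_nat (card Subs) = count ?a / count ?b"
    using total by simp
  also have "\<dots> = (\<Prod>i<length \<beta>. gauss_coeff (?a i - ?b (Suc i)) (?b i - ?b (Suc i)) (of_nat q)
       * of_nat q ^ (?b (Suc i) * (?a i - ?b i)))"
    unfolding count_def prod_dividef[symmetric]
    using residue_card_ge_2 sub partition_antimono[OF \<beta>] \<mu>
    by (intro quotient_of_counts_eq_gauss_coeffs) (auto simp: partition_subset_def nth_default_def)
  finally show ?thesis
    by (simp add: Subs_def)
qed

end

theorem theorem6p1:
  fixes R :: "('a, 'k) ring_scheme" and P :: "'a set"
    and M :: "('a, 'b, 'm) module_scheme"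
    and \<alpha> \<beta> :: "nat list" and q :: nat
  assumes "discrete_valuation_ring R P"
    and "finite (carrier (R Quot P))" and "card (carrier (R Quot P)) = q"
    and "is_partition \<alpha>" and "is_partition \<beta>" and "partition_subset \<beta> \<alpha>"
    and "module R M" and "finite (carrier M)"
    and "has_type R P M (conjugate_partition \<alpha>)"
  shows "of_nat (card {N. submodule N R M \<and>
                          has_type R P (M\<lparr>carrier := N\<rparr>) (conjugate_partition \<beta>)}) =
    (\<Prod>i<length \<beta>.
       gauss_coeff (nth_default 0 \<alpha> i - nth_default 0 \<beta> (Suc i))
                   (nth_default 0 \<beta> i - nth_default 0 \<beta> (Suc i)) (of_nat q)
       * of_nat q ^ (nth_default 0 \<beta> (Suc i) * (nth_default 0 \<alpha> i - nth_default 0 \<beta> i)))"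
proof -
  interpret dvr: discrete_valuation_ring R P
    by fact
  obtain p where p: "p \<in> carrier R" "P = PIdl\<^bsub>R\<^esub> p"
    using dvr.exists_gen[OF dvr.is_ideal] by auto
  interpret module_over_dvr R M P p q
    using assms p by (simp add: module_over_dvr_def module_over_dvr_axioms_def)
  show ?thesis
    by (rule card_submodules_of_type) fact+
qed

end
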